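(* For a fixed finite alphabet $\Sigma$, there is an algorithm that, given an $m\times n$ array $A$ over $\Sigma$, decides whether $A$ is primitive and computes the primitive root of $A$ (together with its dimensions) in $O(mn)$ time.
   Context: For an $m\times n$ array $A$ (indexed from $0$) and positive integers $p,q$, $A^{p\times q}$ is the $pm \times qn$ array $B$ with $B[i,j] = A[i \bmod m, j \bmod n]$. A nonempty array $M$ is primitive if $M = B^{p\times q}$ with $p,q$ positive integers implies $p=q=1$. Every nonempty array $A$ can be written as $A = C^{i\times j}$ for a unique primitive array $C$ and positive integers $i,j$; this $C$ is the primitive root of $A$. Running time is measured in the standard RAM model. *)

theory Defs
  imports Complex_Main "Jordan_Normal_Form.Matrix"
begin

section \<open>Primitive arrays\<close>

definition array_power :: "'a mat \<Rightarrow> nat \<Rightarrow> nat \<Rightarrow> 'a mat" where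
  "array_power A p q =
     mat (p * dim_row A) (q * dim_col A) (\<lambda>(i, j). A $$ (i mod dim_row A, j mod dim_col A))"

definition nonempty_array :: "'a mat \<Rightarrow> bool" where
  "nonempty_array A \<longleftrightarrow> dim_row A > 0 \<and> dim_col A > 0"

definition primitive_array :: "'a mat \<Rightarrow> bool" where
  "primitive_array M \<longleftrightarrow> nonempty_array M \<and>
     (\<forall>B p q. p > 0 \<longrightarrow> q > 0 \<longrightarrow> M = array_power B p q \<longrightarrow> p = 1 \<and> q = 1)"

definition primitive_root :: "'a mat \<Rightarrow> 'a mat" where
  "primitive_root A =
     (THE C. primitive_array C \<and> (\<exists>i j. i > 0 \<and> j > 0 \<and> A = array_power C i j))"

lemma dim_array_power [simp]:
  "dim_row (array_power A p q) = p * dim_row A"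
  "dim_col (array_power A p q) = q * dim_col A"
  by (simp_all add: array_power_def)

lemma index_array_power [simp]:
  "i < p * dim_row A \<Longrightarrow> j < q * dim_col A \<Longrightarrow>
     array_power A p q $$ (i, j) = A $$ (i mod dim_row A, j mod dim_col A)"
  by (simp add: array_power_def)

lemma array_power_array_power:
  "array_power (array_power C i j) p q = array_power C (p * i) (q * j)"
proof (rule eq_matI, goal_cases)
  case (1 a b)
  have "0 < i * dim_row C" "0 < j * dim_col C" using 1 by (auto intro: Nat.gr0I)
  hence "a mod (i * dim_row C) < i * dim_row C" "b mod (j * dim_col C) < j * dim_col C"
    by simp_all
  thus ?case using 1 by (simp add: mult.assoc mod_mod_cancel)
qed (simp_all add: mult.assoc)

lemma array_power_1_1: "array_power A (Suc 0) (Suc 0) = A"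
  by (rule eq_matI) auto

lemma transpose_array_power:
  "transpose_mat (array_power C i j) = array_power (transpose_mat C) j i"
proof (rule eq_matI, goal_cases)
  case (1 a b)
  have "0 < dim_row C" "0 < dim_col C" using 1 by (auto intro: Nat.gr0I)
  thus ?case using 1 by simp
qed simp_all

lemma primitive_array_transpose:
  assumes "primitive_array C"
  shows "primitive_array (transpose_mat C)"
  unfolding primitive_array_def
proof (intro conjI allI impI)
  show "nonempty_array (transpose_mat C)"
    using assms by (simp add: primitive_array_def nonempty_array_def)
  fix B p q assume pq: "0 < (p::nat)" "0 < (q::nat)" "transpose_mat C = array_power B p q"
  hence "C = array_power (transpose_mat B) q p"
    by (metis transpose_array_power Matrix.transpose_transpose)
  with assms pq show "p = 1" "q = 1" unfolding primitive_array_def by metis+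
qed

lemma primitive_root_exists:
  assumes "nonempty_array A"
  shows "\<exists>C i j. primitive_array C \<and> i > 0 \<and> j > 0 \<and> A = array_power C i j"
  using assms
proof (induction "dim_row A * dim_col A" arbitrary: A rule: less_induct)
  case less
  show ?case
  proof (cases "primitive_array A")
    case True
    thus ?thesis using array_power_1_1[of A] by (metis zero_less_Suc)
  next
    case False
    then obtain B p q where B: "p > 0" "q > 0" "A = array_power B p q" "p \<noteq> 1 \<or> q \<noteq> 1"
      using less.prems unfolding primitive_array_def by blast
    have ne: "dim_row B > 0" "dim_col B > 0"
      using less.prems B by (simp_all add: nonempty_array_def)
    have "p * q > 1" using B by (metis One_nat_def Suc_lessI mult_eq_1_iff nat_0_less_mult_iff)
    hence "1 * (dim_row B * dim_col B) < (p * q) * (dim_row B * dim_col B)"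
      using ne by (intro mult_strict_right_mono) auto
    hence "dim_row B * dim_col B < dim_row A * dim_col A"
      using B by (simp add: ac_simps)
    then obtain C i j where "primitive_array C" "i > 0" "j > 0" "B = array_power C i j"
      using less.hyps[of B] ne by (auto simp: nonempty_array_def)
    thus ?thesis using B array_power_array_power[of C i j p q]
      by (metis nat_0_less_mult_iff)
  qed
qed

lemma primitive_dim_row_dvd:
  assumes C: "primitive_array C" and ij: "i > 0" "j > 0"
    and D: "nonempty_array D" and kl: "k > 0" "l > 0"
    and eq: "array_power C i j = array_power D k l"
  shows "dim_row C dvd dim_row D"
proof -
  define r s g where "r = dim_row C" and "s = dim_row D" and "g = gcd r s"
  have pos: "r > 0" "s > 0" "g > 0" "dim_col C > 0"
    using C D by (auto simp: r_def s_def g_def primitive_array_def nonempty_array_def)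
  have m: "i * r = k * s"
    using arg_cong[OF eq, of dim_row] by (simp add: r_def s_def)
  have n: "j * dim_col C = l * dim_col D"
    using arg_cong[OF eq, of dim_col] by simp
  define f where "f a b = array_power C i j $$ (a mod (i * r), b)" for a b
  have fC: "f a b = C $$ (a mod r, b mod dim_col C)" if "b < j * dim_col C" for a b
    unfolding f_def using that pos ij by (simp add: r_def mod_mod_cancel)
  have fD: "f a b = D $$ (a mod s, b mod dim_col D)" if "b < j * dim_col C" for a b
    unfolding f_def eq m using that pos kl n by (simp add: s_def mod_mod_cancel)
  obtain x y where xy: "r * x = s * y + g"
    using bezout_nat[of r s] pos unfolding g_def by auto
  have fg: "f (a + g) b = f a b" if b: "b < j * dim_col C" for a b
  proof -
    have "f (a + g) b = f (a + g + s * y) b" using b by (simp add: fD)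
    also have "a + g + s * y = a + r * x" using xy by simp
    also have "f \<dots> b = f a b" using b by (simp add: fC)
    finally show ?thesis .
  qed
  have fgt: "f (a + t * g) b = f a b" if b: "b < j * dim_col C" for a b t
  proof (induction t)
    case (Suc t)
    have "f (a + Suc t * g) b = f (a + t * g + g) b" by (simp add: ac_simps)
    thus ?case using Suc fg[OF b] by simp
  qed simp
  have fmod: "f a b = f (a mod g) b" if b: "b < j * dim_col C" for a b
    using fgt[OF b, of "a mod g" "a div g"] by (simp add: mod_div_mult_eq)
  define B where "B = mat g (dim_col C) (\<lambda>(a, b). C $$ (a, b))"
  have gr: "g dvd r" "g \<le> r" using pos by (auto simp: g_def intro: dvd_imp_le)
  have "C = array_power B (r div g) 1"
  proof (rule eq_matI, goal_cases)
    case (1 a b)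
    have ab: "a < r" "b < dim_col C" using 1 gr by (simp_all add: B_def)
    have bj: "b < j * dim_col C"
      using ab ij by (metis Suc_leI less_le_trans mult_1 mult_le_mono1 One_nat_def)
    have ag: "a mod g < g" "a mod g < r" using pos gr mod_less_divisor[of g a] by linarith+
    have "C $$ (a, b) = C $$ (a mod g, b)"
      using fmod[OF bj, of a] ab ag by (simp add: fC[OF bj])
    thus ?case using ab ag gr 1 by (simp add: B_def)
  qed (use gr in \<open>simp_all add: B_def r_def\<close>)
  moreover have "r div g > 0" using pos gr by (simp add: div_greater_zero_iff)
  moreover have "p = 1" if "p > 0" "C = array_power B p 1" for p
    using C that unfolding primitive_array_def by (metis less_numeral_extra(1))
  ultimately have "r div g = 1" by blast
  hence "r = g" using gr by (metis dvd_div_mult_self mult_1)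
  thus ?thesis unfolding g_def r_def s_def by (metis gcd_dvd2)
qed

lemma primitive_dim_col_dvd:
  assumes C: "primitive_array C" and ij: "i > 0" "j > 0"
    and D: "nonempty_array D" and kl: "k > 0" "l > 0"
    and eq: "array_power C i j = array_power D k l"
  shows "dim_col C dvd dim_col D"
proof -
  have "array_power (transpose_mat C) j i = array_power (transpose_mat D) l k"
    using eq by (metis transpose_array_power)
  moreover have "nonempty_array (transpose_mat D)" using D by (simp add: nonempty_array_def)
  ultimately show ?thesis
    using primitive_dim_row_dvd[OF primitive_array_transpose[OF C] ij(2,1) _ kl(2,1),
        of "transpose_mat D"] by simp
qed

lemma primitive_root_unique:
  assumes C: "primitive_array C" "i > 0" "j > 0"
    and D: "primitive_array D" "k > 0" "l > 0"
    and eq: "array_power C i j = array_power D k l"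
  shows "C = D"
proof -
  have ne: "nonempty_array C" "nonempty_array D" using C D by (simp_all add: primitive_array_def)
  have r: "dim_row C = dim_row D" and c: "dim_col C = dim_col D"
    using primitive_dim_row_dvd[OF C ne(2) D(2,3) eq] primitive_dim_row_dvd[OF D ne(1) C(2,3) eq[symmetric]]
      primitive_dim_col_dvd[OF C ne(2) D(2,3) eq] primitive_dim_col_dvd[OF D ne(1) C(2,3) eq[symmetric]]
    by (simp_all add: dvd_antisym)
  show ?thesis
  proof (rule eq_matI[OF _ r c])
    fix a b assume ab: "a < dim_row D" "b < dim_col D"
    have le: "x < t * y" if "x < y" "t > 0" for x y t :: nat
      using that by (metis Suc_leI less_le_trans mult_1 mult_le_mono1 One_nat_def)
    show "C $$ (a, b) = D $$ (a, b)"
      using arg_cong[OF eq, of "\<lambda>M. M $$ (a, b)"] ab C D r c by (simp add: le)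
  qed
qed

theorem primitive_root_ex1:
  assumes "nonempty_array A"
  shows "\<exists>!C. primitive_array C \<and> (\<exists>i j. i > 0 \<and> j > 0 \<and> A = array_power C i j)"
  using primitive_root_exists[OF assms] primitive_root_unique by metis


section \<open>Random access machine\<close>

text \<open>
  A unit-cost word RAM: a program is a fixed list of instructions operating on registers and
  on a random-access memory, both holding natural numbers. Register operands are part of the
  instruction, so a program uses finitely many registers. \<open>Sub\<close> is truncated subtraction and
  division by \<open>0\<close> yields \<open>0\<close>.
\<close>

datatype instr =
    Const nat nat       \<comment> \<open>\<open>R\<^sub>a := c\<close>\<close>
  | Add nat nat nat     \<comment> \<open>\<open>R\<^sub>a := R\<^sub>b + R\<^sub>c\<close>; likewise for the next three\<close>
  | Sub nat nat nat
  | Mul nat nat nat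
  | Div nat nat nat
  | Load nat nat        \<comment> \<open>\<open>R\<^sub>a := M[R\<^sub>b]\<close>\<close>
  | Store nat nat       \<comment> \<open>\<open>M[R\<^sub>a] := R\<^sub>b\<close>\<close>
  | Jump nat            \<comment> \<open>continue at instruction \<open>l\<close>\<close>
  | JumpZ nat nat       \<comment> \<open>continue at instruction \<open>l\<close> if \<open>R\<^sub>a = 0\<close>\<close>

record config =
  pc :: nat
  reg :: "nat \<Rightarrow> nat"
  mem :: "nat \<Rightarrow> nat"

definition set_reg :: "nat \<Rightarrow> nat \<Rightarrow> config \<Rightarrow> config" where
  "set_reg a v s = s\<lparr>pc := pc s + 1, reg := (reg s)(a := v)\<rparr>"

fun exec_instr :: "instr \<Rightarrow> config \<Rightarrow> config" where
  "exec_instr (Const a c) s = set_reg a c s"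
| "exec_instr (Add a b c) s = set_reg a (reg s b + reg s c) s"
| "exec_instr (Sub a b c) s = set_reg a (reg s b - reg s c) s"
| "exec_instr (Mul a b c) s = set_reg a (reg s b * reg s c) s"
| "exec_instr (Div a b c) s = set_reg a (reg s b div reg s c) s"
| "exec_instr (Load a b) s = set_reg a (mem s (reg s b)) s"
| "exec_instr (Store a b) s = s\<lparr>pc := pc s + 1, mem := (mem s)(reg s a := reg s b)\<rparr>"
| "exec_instr (Jump l) s = s\<lparr>pc := l\<rparr>"
| "exec_instr (JumpZ a l) s = s\<lparr>pc := (if reg s a = 0 then l else pc s + 1)\<rparr>"

definition fits :: "nat \<Rightarrow> config \<Rightarrow> bool" where
  "fits w s \<longleftrightarrow> (\<forall>a. reg s a < 2 ^ w) \<and> (\<forall>a. mem s a < 2 ^ w)"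

text \<open>
  An instruction whose result does not fit into a \<open>w\<close>-bit word gets the machine stuck without
  halting. Without this restriction unit-cost multiplication would be unrealistically strong.
\<close>

definition ram_step :: "instr list \<Rightarrow> nat \<Rightarrow> config \<Rightarrow> config \<Rightarrow> bool" where
  "ram_step P w s s' \<longleftrightarrow> pc s < length P \<and> s' = exec_instr (P ! pc s) s \<and> fits w s'"

definition halted :: "instr list \<Rightarrow> config \<Rightarrow> bool" where
  "halted P s \<longleftrightarrow> pc s \<ge> length P"

definition ram_run :: "instr list \<Rightarrow> nat \<Rightarrow> nat \<Rightarrow> config \<Rightarrow> config \<Rightarrow> bool" where
  "ram_run P w t s s' \<longleftrightarrow> fits w s \<and> (ram_step P w ^^ t) s s' \<and> halted P s'"

text \<open>
  Input and output conventions. Letters are represented by numbers through \<open>code\<close>, arrays are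
  stored in row-major order from address \<open>0\<close>. Input: the dimensions in registers 0 and 1, the
  array in memory, everything else \<open>0\<close>. Output: the primitivity bit in register 0, the
  dimensions of the root in registers 1 and 2, the root in memory.
\<close>

definition input_config :: "('a \<Rightarrow> nat) \<Rightarrow> 'a mat \<Rightarrow> config" where
  "input_config code A =
     \<lparr> pc = 0,
       reg = (\<lambda>_. 0)(0 := dim_row A, 1 := dim_col A),
       mem = (\<lambda>a. if a < dim_row A * dim_col A
                  then code (A $$ (a div dim_col A, a mod dim_col A)) else 0) \<rparr>"

definition stores_array :: "('a \<Rightarrow> nat) \<Rightarrow> config \<Rightarrow> 'a mat \<Rightarrow> bool" where
  "stores_array code s C \<longleftrightarrow>
     (\<forall>i < dim_row C. \<forall>j < dim_col C. mem s (i * dim_col C + j) = code (C $$ (i, j)))"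

definition output_correct :: "('a \<Rightarrow> nat) \<Rightarrow> 'a mat \<Rightarrow> config \<Rightarrow> bool" where
  "output_correct code A s \<longleftrightarrow>
     reg s 0 = (if primitive_array A then 1 else 0) \<and>
     reg s 1 = dim_row (primitive_root A) \<and>
     reg s 2 = dim_col (primitive_root A) \<and>
     stores_array code s (primitive_root A)"

end

theory Submission
  imports Defs
begin

text \<open>
  Periods in the two directions are independent: if \<open>r\<close> is the least divisor of \<open>m\<close> that is a
  period of the rows and \<open>c\<close> the least divisor of \<open>n\<close> that is a period of the columns, then the
  top left \<open>r \<times> c\<close> corner is the primitive root. Read row by row, the array is a string of length
  \<open>N = m n\<close>, and \<open>d\<close> is a row period iff this string agrees with its suffix starting at \<open>d n\<close>.
  All longest common extensions of the string with its suffixes (the Z-function) are computed in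
  linear time: the right end of the rightmost known match never decreases, and every letter
  comparison that succeeds moves it. Columns are treated by reading the array column by column.
\<close>

section \<open>Structured programs and their weakest preconditions\<close>

text \<open>Correctness and step count are proved together: preconditions carry credits, and 22
  times the right end of the rightmost match is the potential that pays for the successful letter
  comparisons of a pass. The machine gets stuck on overflow, so every sum and product needs a bound
  below \<open>2 ^ w\<close>. The extension table occupies addresses \<open>N\<close> to
  \<open>2 * N\<close>, which is the origin of \<open>2 * N < 2 ^ w\<close>. Equality tests,
  remainders and register moves are built from truncated subtraction, division and addition.
  Candidate periods are divisors of the dimension, hence exactly the heights (or widths) of blocks
  that tile the array; so every factorisation of the array yields candidates, and minimality of both
  periods makes the corner primitive.\<close>

datatype com =
    Basic "instr list"
  | Seq com com (infixr \<open>;;\<close> 60)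
  | Cond nat com com
  | Loop com nat com

fun com_length :: "com \<Rightarrow> nat" where
  "com_length (Basic xs) = length xs"
| "com_length (c ;; d) = com_length c + com_length d"
| "com_length (Cond a c d) = com_length c + com_length d + 2"
| "com_length (Loop c a d) = com_length c + com_length d + 2"

text \<open>Jump targets are absolute, so the start address \<open>p\<close> is threaded through the
  translation.\<close>

fun compile :: "nat \<Rightarrow> com \<Rightarrow> instr list" where
  "compile p (Basic xs) = xs"
| "compile p (c ;; d) = compile p c @ compile (p + com_length c) d"
| "compile p (Cond a c d) =
     [JumpZ a (p + com_length c + 2)] @ compile (p + 1) c @
     [Jump (p + com_length c + com_length d + 2)] @ compile (p + com_length c + 2) d"
| "compile p (Loop c a d) =
     compile p c @ [JumpZ a (p + com_length c + com_length d + 2)] @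
     compile (p + com_length c + 1) d @ [Jump p]"

lemma length_compile [simp]: "length (compile p c) = com_length c"
  by (induction c arbitrary: p) auto

definition code_at :: "instr list \<Rightarrow> nat \<Rightarrow> instr list \<Rightarrow> bool" where
  "code_at P p xs \<longleftrightarrow> (\<exists>us vs. P = us @ xs @ vs \<and> length us = p)"

lemma code_at_append:
  assumes "code_at P p (xs @ js)"
  shows "code_at P p xs" "code_at P (p + length xs) js"
proof -
  obtain us vs where P: "P = us @ (xs @ js) @ vs" "length us = p"
    using assms unfolding code_at_def by blast
  show "code_at P p xs" unfolding code_at_def using P by (metis append.assoc)
  have "P = (us @ xs) @ js @ vs" "length (us @ xs) = p + length xs" using P by auto
  thus "code_at P (p + length xs) js" unfolding code_at_def by blast
qed

lemma code_at_Cons: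
  assumes "code_at P p (i # xs)"
  shows "p < length P" "P ! p = i" "code_at P (Suc p) xs"
proof -
  obtain us vs where "P = us @ (i # xs) @ vs" "length us = p"
    using assms unfolding code_at_def by blast
  thus "p < length P" "P ! p = i" by (auto simp: nth_append)
  show "code_at P (Suc p) xs" using code_at_append(2)[of P p "[i]" xs] assms by simp
qed

section \<open>Preconditions with a step budget\<close>

type_synonym store = "nat \<Rightarrow> nat"

text \<open>The last argument of the postcondition is the number of steps that may still be spent.\<close>

definition wp :: "nat \<Rightarrow> com \<Rightarrow> (store \<Rightarrow> store \<Rightarrow> nat \<Rightarrow> bool) \<Rightarrow> store \<Rightarrow> store \<Rightarrow> nat \<Rightarrow> bool" where
  "wp w c Q R M k \<longleftrightarrow>
     (\<forall>P s. code_at P (pc s) (compile (pc s) c) \<longrightarrow> reg s = R \<longrightarrow> mem s = M \<longrightarrow> fits w s \<longrightarrow>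
        (\<exists>t s'. t \<le> k \<and> (ram_step P w ^^ t) s s' \<and> fits w s' \<and> pc s' = pc s + com_length c \<and>
                Q (reg s') (mem s') (k - t)))"

lemma wpI:
  assumes "\<And>P s. code_at P (pc s) (compile (pc s) c) \<Longrightarrow> reg s = R \<Longrightarrow> mem s = M \<Longrightarrow> fits w s \<Longrightarrow>
     \<exists>t s'. t \<le> k \<and> (ram_step P w ^^ t) s s' \<and> fits w s' \<and> pc s' = pc s + com_length c \<and>
            Q (reg s') (mem s') (k - t)"
  shows "wp w c Q R M k"
  using assms unfolding wp_def by blast

lemma wpD:
  assumes "wp w c Q (reg s) (mem s) k" "code_at P (pc s) (compile (pc s) c)" "fits w s"
  obtains t s' where "t \<le> k" "(ram_step P w ^^ t) s s'" "fits w s'" "pc s' = pc s + com_length c"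
    "Q (reg s') (mem s') (k - t)"
  using assms unfolding wp_def by blast

lemma wp_mono:
  assumes "wp w c Q R M k" "\<And>R' M' k'. Q R' M' k' \<Longrightarrow> Q' R' M' k'"
  shows "wp w c Q' R M k"
  using assms unfolding wp_def by blast

text \<open>Straight-line code costs its length, so credits do not occur and jumps are excluded.
  Truncated subtraction and division cannot overflow; a loaded word fits because the whole
  configuration does, so its bound is an assumption.\<close>

fun wp_instrs :: "nat \<Rightarrow> instr list \<Rightarrow> (store \<Rightarrow> store \<Rightarrow> bool) \<Rightarrow> store \<Rightarrow> store \<Rightarrow> bool" where
  "wp_instrs w [] Q R M \<longleftrightarrow> Q R M"
| "wp_instrs w (Const a c # xs) Q R M \<longleftrightarrow> c < 2 ^ w \<and> wp_instrs w xs Q (R(a := c)) M"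
| "wp_instrs w (Add a b c # xs) Q R M \<longleftrightarrow>
     R b + R c < 2 ^ w \<and> wp_instrs w xs Q (R(a := R b + R c)) M"
| "wp_instrs w (Sub a b c # xs) Q R M \<longleftrightarrow> wp_instrs w xs Q (R(a := R b - R c)) M"
| "wp_instrs w (Mul a b c # xs) Q R M \<longleftrightarrow>
     R b * R c < 2 ^ w \<and> wp_instrs w xs Q (R(a := R b * R c)) M"
| "wp_instrs w (Div a b c # xs) Q R M \<longleftrightarrow> wp_instrs w xs Q (R(a := R b div R c)) M"
| "wp_instrs w (Load a b # xs) Q R M \<longleftrightarrow>
     (M (R b) < 2 ^ w \<longrightarrow> wp_instrs w xs Q (R(a := M (R b))) M)"
| "wp_instrs w (Store a b # xs) Q R M \<longleftrightarrow> wp_instrs w xs Q R (M(R a := R b))"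
| "wp_instrs w (Jump l # xs) Q R M \<longleftrightarrow> False"
| "wp_instrs w (JumpZ a l # xs) Q R M \<longleftrightarrow> False"

lemma wp_instrs_mono:
  "wp_instrs w xs Q R M \<Longrightarrow> (\<And>R' M'. Q R' M' \<Longrightarrow> Q' R' M') \<Longrightarrow> wp_instrs w xs Q' R M"
  by (induction w xs Q R M rule: wp_instrs.induct) auto

lemma wp_instrs_step:
  assumes "wp_instrs w (i # xs) Q (reg s) (mem s)" "fits w s"
  shows "pc (exec_instr i s) = Suc (pc s)" "fits w (exec_instr i s)"
    "wp_instrs w xs Q (reg (exec_instr i s)) (mem (exec_instr i s))"
proof -
  have le: "x - y < 2 ^ w" "x div y < 2 ^ w" if "x < 2 ^ w" for x y :: nat
    using that by (meson diff_le_self div_le_dividend le_less_trans)+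
  show "pc (exec_instr i s) = Suc (pc s)" "fits w (exec_instr i s)"
    "wp_instrs w xs Q (reg (exec_instr i s)) (mem (exec_instr i s))"
    using assms by (cases i; auto simp: set_reg_def fits_def intro: le)+
qed

lemma wp_instrs_run:
  assumes "code_at P (pc s) xs" "wp_instrs w xs Q (reg s) (mem s)" "fits w s"
  shows "\<exists>s'. (ram_step P w ^^ length xs) s s' \<and> fits w s' \<and> pc s' = pc s + length xs \<and>
              Q (reg s') (mem s')"
  using assms
proof (induction xs arbitrary: s)
  case (Cons i xs)
  let ?s = "exec_instr i s"
  note step = wp_instrs_step[OF Cons.prems(2,3)]
  note code = code_at_Cons[OF Cons.prems(1)]
  have "ram_step P w s ?s" using code step by (simp add: ram_step_def)
  moreover obtain s' where "(ram_step P w ^^ length xs) ?s s'" "fits w s'"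
    "pc s' = pc ?s + length xs" "Q (reg s') (mem s')"
    using Cons.IH[of ?s] code step by auto
  ultimately have "(ram_step P w ^^ length (i # xs)) s s'" "fits w s'"
    "pc s' = pc s + length (i # xs)" "Q (reg s') (mem s')"
    using step(1) by (auto intro: relpowp_Suc_I2 simp del: relpowp.simps)
  thus ?case by blast
qed simp

lemma wp_Basic:
  assumes "length xs = n" "n \<le> k" "wp_instrs w xs (\<lambda>R M. Q R M (k - n)) R M"
  shows "wp w (Basic xs) Q R M k"
proof (rule wpI, goal_cases)
  case (1 P s)
  thus ?case using wp_instrs_run[of P s xs w "\<lambda>R M. Q R M (k - n)"] assms
    by (intro exI[of _ n]) simp
qed

lemma wp_Seq:
  assumes "wp w c (wp w d Q) R M k"
  shows "wp w (c ;; d) Q R M k"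
proof (rule wpI, goal_cases)
  case (1 P s)
  note code = code_at_append[OF 1(1)[unfolded compile.simps]]
  obtain t s1 where t: "t \<le> k" "(ram_step P w ^^ t) s s1" "fits w s1"
    "pc s1 = pc s + com_length c" "wp w d Q (reg s1) (mem s1) (k - t)"
    using assms 1 code by (auto elim: wpD)
  obtain u s2 where u: "u \<le> k - t" "(ram_step P w ^^ u) s1 s2" "fits w s2"
    "pc s2 = pc s1 + com_length d" "Q (reg s2) (mem s2) (k - t - u)"
    using t code by (auto elim: wpD)
  have "(ram_step P w ^^ (t + u)) s s2" using t u by (auto simp: relpowp_add)
  thus ?case using t u by (intro exI[of _ "t + u"] exI[of _ s2]) auto
qed

lemma ram_step_JumpZ:
  assumes "code_at P (pc s) (JumpZ a l # xs)" "fits w s"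
  shows "ram_step P w s (s\<lparr>pc := (if reg s a = 0 then l else Suc (pc s))\<rparr>)"
  using code_at_Cons[OF assms(1)] assms(2) by (simp add: ram_step_def fits_def)

lemma ram_step_Jump:
  assumes "code_at P (pc s) (Jump l # xs)" "fits w s"
  shows "ram_step P w s (s\<lparr>pc := l\<rparr>)"
  using code_at_Cons[OF assms(1)] assms(2) by (simp add: ram_step_def fits_def)

lemma fits_pc [simp]: "fits w (s\<lparr>pc := p\<rparr>) = fits w s"
  by (simp add: fits_def)

text \<open>The nonzero branch ends with a jump over the other branch; that jump is the extra credit
  demanded after \<open>c\<close>.\<close>

lemma wp_Cond:
  assumes "k \<ge> 1"
    and "R a \<noteq> 0 \<Longrightarrow> wp w c (\<lambda>R M k. k \<ge> 1 \<and> Q R M (k - 1)) R M (k - 1)"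
    and "R a = 0 \<Longrightarrow> wp w d Q R M (k - 1)"
  shows "wp w (Cond a c d) Q R M k"
proof (rule wpI, goal_cases)
  case (1 P s)
  note code = 1(1)[unfolded compile.simps]
  note c1 = code_at_append[OF code]
  note c2 = code_at_append[OF c1(2)]
  note c3 = code_at_append[OF c2(2)]
  define s1 where "s1 = s\<lparr>pc := (if R a = 0 then pc s + com_length c + 2 else Suc (pc s))\<rparr>"
  have s1: "ram_step P w s s1" "fits w s1" "reg s1 = R" "mem s1 = M"
    using ram_step_JumpZ[OF c1(1)] 1 by (simp_all add: s1_def)
  show ?case
  proof (cases "R a = 0")
    case True
    obtain t s2 where t: "t \<le> k - 1" "(ram_step P w ^^ t) s1 s2" "fits w s2"
      "pc s2 = pc s1 + com_length d" "Q (reg s2) (mem s2) (k - 1 - t)"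
    proof (rule wpD[of w d Q s1 "k - 1" P])
      show "code_at P (pc s1) (compile (pc s1) d)" using c3(2) True by (simp add: s1_def)
    qed (use assms(3) True s1 in auto)
    have "(ram_step P w ^^ Suc t) s s2" using s1(1) t(2) by (rule relpowp_Suc_I2)
    thus ?thesis using t assms(1) True
      by (intro exI[of _ "Suc t"] exI[of _ s2]) (auto simp: s1_def)
  next
    case False
    obtain t s2 where t: "t \<le> k - 1" "(ram_step P w ^^ t) s1 s2" "fits w s2"
      "pc s2 = pc s1 + com_length c" "k - 1 - t \<ge> 1" "Q (reg s2) (mem s2) (k - 1 - t - 1)"
    proof (rule wpD[of w c "\<lambda>R M k. k \<ge> 1 \<and> Q R M (k - 1)" s1 "k - 1" P])
      show "code_at P (pc s1) (compile (pc s1) c)" using c2(1) False by (simp add: s1_def)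
    qed (use assms(2) False s1 in auto)
    let ?s3 = "s2\<lparr>pc := pc s + com_length c + com_length d + 2\<rparr>"
    have "ram_step P w s2 ?s3"
      by (rule ram_step_Jump[where xs = "[]"]) (use c3(1) t False in \<open>simp_all add: s1_def\<close>)
    hence "(ram_step P w ^^ Suc (Suc t)) s ?s3"
      using s1(1) t(2) by (meson relpowp_Suc_I relpowp_Suc_I2)
    thus ?thesis using t assms(1) by (intro exI[of _ "Suc (Suc t)"] exI[of _ ?s3]) auto
  qed
qed

text \<open>No variant is needed, because every iteration spends credits.\<close>

lemma wp_Loop:
  assumes inv: "\<And>R M k. I R M k \<Longrightarrow>
     wp w c (\<lambda>R M k. k \<ge> 1 \<and> (if R a = 0 then Q R M (k - 1)
                               else wp w d (\<lambda>R M k. k \<ge> 1 \<and> I R M (k - 1)) R M (k - 1))) R M k"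
    and "I R M k"
  shows "wp w (Loop c a d) Q R M k"
  using assms(2)
proof (induction k arbitrary: R M rule: less_induct)
  case (less k)
  show ?case
  proof (rule wpI, goal_cases)
    case (1 P s)
    note code = 1(1)[unfolded compile.simps]
    note c1 = code_at_append[OF code]
    note c2 = code_at_append[OF c1(2)]
    note c3 = code_at_append[OF c2(2)]
    let ?J = "\<lambda>R M k. k \<ge> 1 \<and> I R M (k - 1)"
    let ?Q = "\<lambda>R M k. k \<ge> 1 \<and> (if R a = 0 then Q R M (k - 1) else wp w d ?J R M (k - 1))"
    have wp: "wp w c ?Q (reg s) (mem s) k" using inv[OF less.prems] 1(2,3) by simp
    obtain t s1 where t: "t \<le> k" "(ram_step P w ^^ t) s s1" "fits w s1"
      "pc s1 = pc s + com_length c" "?Q (reg s1) (mem s1) (k - t)"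
      by (rule wpD[OF wp c1(1) 1(4)])
    define s2 where "s2 = s1\<lparr>pc := (if reg s1 a = 0 then pc s + com_length c + com_length d + 2
                                     else Suc (pc s1))\<rparr>"
    have "ram_step P w s1 s2"
      unfolding s2_def by (rule ram_step_JumpZ[where xs = "[]"]) (use c2(1) t in simp_all)
    hence run2: "(ram_step P w ^^ Suc t) s s2" using t(2) by (meson relpowp_Suc_I)
    have s2: "fits w s2" "reg s2 = reg s1" "mem s2 = mem s1" using t by (simp_all add: s2_def)
    show ?case
    proof (cases "reg s1 a = 0")
      case True
      thus ?thesis using run2 s2 t
        by (intro exI[of _ "Suc t"] exI[of _ s2]) (auto simp: s2_def)
    next
      case False
      have pc2: "pc s2 = pc s + com_length c + 1" using False t by (simp add: s2_def)
      have wp2: "wp w d ?J (reg s2) (mem s2) (k - t - 1)" using t(5) False s2 by simp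
      have code2: "code_at P (pc s2) (compile (pc s2) d)" using c3(1) pc2 by simp
      obtain u s3 where u: "u \<le> k - t - 1" "(ram_step P w ^^ u) s2 s3" "fits w s3"
        "pc s3 = pc s2 + com_length d" "?J (reg s3) (mem s3) (k - t - 1 - u)"
        by (rule wpD[OF wp2 code2 s2(1)])
      let ?s4 = "s3\<lparr>pc := pc s\<rparr>" and ?k = "k - t - 1 - u - 1"
      have "ram_step P w s3 ?s4"
        by (rule ram_step_Jump[where xs = "[]"]) (use c3(2) u pc2 in simp_all)
      hence "(ram_step P w ^^ (Suc t + Suc u)) s ?s4"
        using run2 u(2) unfolding relpowp_add by (meson relcomppI relpowp_Suc_I)
      moreover have "wp w (Loop c a d) Q (reg ?s4) (mem ?s4) ?k"
      proof -
        have "?k < k" using u(5) by linarith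
        from less.IH[OF this] u(5) show ?thesis by simp
      qed
      then obtain v s5 where v: "v \<le> ?k" "(ram_step P w ^^ v) ?s4 s5" "fits w s5"
        "pc s5 = pc ?s4 + com_length (Loop c a d)" "Q (reg s5) (mem s5) (?k - v)"
        by (rule wpD) (use 1 u in simp_all)
      ultimately have "(ram_step P w ^^ (Suc t + Suc u + v)) s s5"
        unfolding relpowp_add by blast
      moreover have "Suc t + Suc u + v \<le> k" using u(5) v(1) by linarith
      ultimately show ?thesis using v
        by (intro exI[of _ "Suc t + Suc u + v"] exI[of _ s5]) (simp add: diff_diff_eq)
    qed
  qed
qed

section \<open>Longest common extensions\<close>

definition is_lce :: "(nat \<Rightarrow> 'b) \<Rightarrow> nat \<Rightarrow> nat \<Rightarrow> nat \<Rightarrow> bool" where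
  "is_lce x N i z \<longleftrightarrow> i + z \<le> N \<and> (\<forall>t<z. x t = x (i + t)) \<and> (i + z < N \<longrightarrow> x z \<noteq> x (i + z))"

lemma is_lce_cong:
  assumes "\<And>k. k < N \<Longrightarrow> x k = y k"
  shows "is_lce x N i z = is_lce y N i z"
proof (cases "i + z \<le> N")
  case True
  thus ?thesis unfolding is_lce_def using assms by auto
qed (simp add: is_lce_def)

text \<open>This is the table's initial entry. At position 1 the window also starts at 1, so the
  first lookup reads it, and the value \<open>N\<close> forces the branch that compares
  letters.\<close>

lemma is_lce_0: "is_lce x N 0 N"
  by (simp add: is_lce_def)

text \<open>The window from \<open>l\<close> to \<open>r\<close> copies a prefix. An extension
  stopping strictly inside it has its mismatch inside as well, so the mismatch is transported
  too.\<close>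

lemma is_lce_shift:
  assumes win: "\<And>t. l + t < r \<Longrightarrow> x t = x (l + t)" and "l \<le> i" "r \<le> N"
    and z: "is_lce x N (i - l) z" and less: "i + z < r"
  shows "is_lce x N i z"
proof -
  have eq: "x (i + t) = x (i - l + t)" if "i + t < r" for t
    using win[of "i - l + t"] that \<open>l \<le> i\<close> by simp
  show ?thesis unfolding is_lce_def
  proof (intro conjI allI impI)
    show "i + z \<le> N" using less \<open>r \<le> N\<close> by simp
    fix t assume "t < z"
    thus "x t = x (i + t)" using z eq[of t] less unfolding is_lce_def by simp
  next
    have "i - l + z < N" using less \<open>r \<le> N\<close> by simp
    thus "x z \<noteq> x (i + z)" using z eq[OF less] unfolding is_lce_def by simp
  qed
qed

text \<open>When the old extension reaches the right end of the window, only agreement up to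
  \<open>r\<close> carries over; letter comparison resumes at \<open>r\<close>.\<close>

lemma is_lce_window:
  assumes win: "\<And>t. l + t < r \<Longrightarrow> x t = x (l + t)" and "l \<le> i"
    and z: "is_lce x N (i - l) z" and "r \<le> i + z" and t: "i + t < r"
  shows "x t = x (i + t)"
proof -
  have "x t = x (i - l + t)" using z assms(4) t unfolding is_lce_def by simp
  also have "\<dots> = x (i + t)" using win[of "i - l + t"] t \<open>l \<le> i\<close> by simp
  finally show ?thesis .
qed

text \<open>This makes a period test constant time: a single table entry replaces the comparison of
  a whole suffix.\<close>

lemma is_lce_maximal_iff:
  assumes "is_lce x N i z"
  shows "z = N - i \<longleftrightarrow> (\<forall>t. i + t < N \<longrightarrow> x t = x (i + t))"
proof
  assume "z = N - i"
  thus "\<forall>t. i + t < N \<longrightarrow> x t = x (i + t)" using assms unfolding is_lce_def by simp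
next
  assume "\<forall>t. i + t < N \<longrightarrow> x t = x (i + t)"
  hence "\<not> i + z < N" using assms unfolding is_lce_def by blast
  thus "z = N - i" using assms unfolding is_lce_def by linarith
qed


section \<open>The least period along one dimension\<close>

text \<open>
  Registers 2 to 7 are parameters: \<open>N\<close>, the constant 1, \<open>P\<close>, \<open>Q\<close>, and the dimensions \<open>m\<close>, \<open>n\<close>
  of the array that the string spells out row by row. The \<open>k\<close>-th letter of the string is at address
  \<open>(k mod P) * Q + k div P\<close>; this is row-major reading for \<open>P = N\<close>, \<open>Q = 1\<close> and column-major
  reading for \<open>P\<close>, \<open>Q\<close> the two dimensions of the stored array. The extension at \<open>i\<close> is stored at
  address \<open>N + i\<close>. Registers 8, 9, 10 hold the current position and the two
  ends of the rightmost known match; register 11 holds the candidate period.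
\<close>

definition extension_cond :: com where
  "extension_cond = Basic
     [Div 12 10 4, Mul 13 12 4, Sub 13 10 13, Mul 13 13 5, Add 12 13 12, Load 12 12,
      Sub 15 10 8,
      Div 13 15 4, Mul 14 13 4, Sub 14 15 14, Mul 14 14 5, Add 13 14 13, Load 13 13,
      Sub 14 12 13, Sub 15 13 12, Add 14 14 15, Sub 14 3 14, Sub 15 2 10, Mul 14 14 15]"

definition extension_loop :: com where
  "extension_loop = Loop extension_cond 14 (Basic [Add 10 10 3])"

text \<open>Register 13 is nonzero iff the looked-up extension ends strictly inside the window; it
  is then the answer. Otherwise \<open>Sub 10 10 8, Add 10 10 8\<close> sets register 10 to the
  maximum of registers 8 and 10, from where matching continues.\<close>

definition lce_body :: com where
  "lce_body =
     Basic [Sub 12 8 9, Add 12 2 12, Load 12 12, Add 13 8 12, Sub 13 10 13] ;;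
     Cond 13 (Basic [])
       (Basic [Sub 10 10 8, Add 10 10 8] ;; extension_loop ;;
        Basic [Sub 12 10 8, Const 13 0, Add 9 8 13]) ;;
     Basic [Add 13 2 8, Store 13 12, Add 8 8 3]"

text \<open>\<open>Store 2 2\<close> writes the entry \<open>N\<close> of position 0 to address
  \<open>N\<close>. The initial window, from 1 to 0, is empty.\<close>

definition lce_table :: com where
  "lce_table =
     Basic [Store 2 2, Const 8 1, Const 9 1, Const 10 0] ;;
     Loop (Basic [Add 12 2 3, Sub 12 12 8]) 12 lce_body"

abbreviation period_test :: "instr list" where
  "period_test \<equiv>
     [Div 12 6 11, Mul 12 12 11, Sub 12 6 12, Mul 13 11 7, Sub 14 2 13, Add 13 2 13, Load 13 13,
      Sub 14 14 13, Add 12 12 14]"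

definition period_search :: com where
  "period_search =
     Basic [Const 11 1] ;;
     Loop (Basic period_test)
       12 (Basic [Add 11 11 3])"

text \<open>Registers 8 to 15 are the scratch space of a search. Register 20 lies outside, so the
  row period kept there survives the second search.\<close>

definition same_params :: "store \<Rightarrow> store \<Rightarrow> bool" where
  "same_params R R0 \<longleftrightarrow> (\<forall>a. a < 8 \<or> 15 < a \<longrightarrow> R a = R0 a)"

lemma same_params_refl [simp]: "same_params R R"
  by (simp add: same_params_def)

lemma same_params_update [simp]:
  "8 \<le> b \<Longrightarrow> b \<le> 15 \<Longrightarrow> same_params (R(b := v)) R0 = same_params R R0"
  "8 \<le> b \<Longrightarrow> b \<le> 15 \<Longrightarrow> same_params R (R0(b := v)) = same_params R R0"
  by (auto simp: same_params_def)

lemma same_params_trans: "same_params R R' \<Longrightarrow> same_params R' R'' \<Longrightarrow> same_params R R''"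
  by (simp add: same_params_def)

section \<open>Correctness and cost of the period search\<close>

locale string_view =
  fixes w N P Q :: nat
  assumes N_pos: "N > 0" and word_size: "2 * N < 2 ^ w"
    and addr_le: "k \<le> N \<Longrightarrow> (k mod P) * Q + k div P \<le> N"
    and addr_less: "k < N \<Longrightarrow> (k mod P) * Q + k div P < N"
begin

definition letter :: "store \<Rightarrow> nat \<Rightarrow> nat" where
  "letter M k = M ((k mod P) * Q + k div P)"

definition params :: "store \<Rightarrow> bool" where
  "params R \<longleftrightarrow> R 2 = N \<and> R 3 = 1 \<and> R 4 = P \<and> R 5 = Q"

lemma params_cong: "same_params R' R \<Longrightarrow> params R' = params R"
  by (simp add: params_def same_params_def)

lemma letter_cong:
  assumes "\<And>a. a < N \<Longrightarrow> M a = M' a" "k < N"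
  shows "letter M k = letter M' k"
  using assms addr_less by (simp add: letter_def)

text \<open>The test is branch-free: the letter at register 10 is read even when that register is
  \<open>N\<close>. For this reason \<open>addr_le\<close> bounds the address at \<open>N\<close> as
  well.\<close>

lemma wp_extension_cond:
  assumes "params R" "R 8 \<le> R 10" "R 10 \<le> N" "19 \<le> k"
    and post: "\<And>R'. same_params R' R \<Longrightarrow> R' 8 = R 8 \<Longrightarrow> R' 10 = R 10 \<Longrightarrow>
      (R' 14 \<noteq> 0 \<longleftrightarrow> R 10 < N \<and> letter M (R 10) = letter M (R 10 - R 8)) \<Longrightarrow> U R' M (k - 19)"
  shows "wp w extension_cond U R M k"
proof -
  have fit: "(q mod P) * Q < 2 ^ w" "(q mod P) * Q + q div P < 2 ^ w" "q div P * P < 2 ^ w"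
    if "q \<le> N" for q
  proof -
    show "(q mod P) * Q < 2 ^ w" "(q mod P) * Q + q div P < 2 ^ w"
      using addr_le[OF that] word_size by linarith+
    have "q div P * P \<le> q" by simp
    thus "q div P * P < 2 ^ w" using that word_size by linarith
  qed
  have diff: "a - b + (b - a) < 2 ^ w" if "a < 2 ^ w" "b < 2 ^ w" for a b :: nat
    using that by linarith
  have flag: "(1 - c) * (N - d) < 2 ^ w" for c d
  proof -
    have "(1 - c) * (N - d) \<le> 1 * N" by (intro mult_mono) auto
    thus ?thesis using word_size by linarith
  qed
  note par = assms(1)[unfolded params_def]
  have le: "R 10 - R 8 \<le> N" using assms by simp
  define a b where "a = letter M (R 10)" and "b = letter M (R 10 - R 8)"
  show ?thesis unfolding extension_cond_def
  proof (rule wp_Basic[where n = 19], goal_cases)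
    case 3
    \<comment> \<open>With truncated subtraction \<open>a - b + (b - a)\<close> is the distance, so
      the first factor is 1 iff the letters agree and 0 otherwise; the second vanishes at the end of
      the string.\<close>
    have "U (R(12 := a, 13 := b, 15 := N - R 10, 14 := (1 - (a - b + (b - a))) * (N - R 10)))
            M (k - 19)"
      by (rule post) (auto simp: a_def b_def)
    thus ?case
      using fit[OF assms(3)] fit[OF le] diff[of a b] flag
      by (simp add: par minus_div_mult_eq_mod letter_def[symmetric] a_def[symmetric]
            b_def[symmetric])
  qed (use assms in simp_all)
qed

text \<open>An iteration takes 19 steps of testing, two jumps and one increment: 22 steps, and
  register 10 grows by one. The final test and the exit jump take 20.\<close>

lemma wp_extension_loop:
  assumes par: "params R" and le: "R 8 \<le> R 10" "R 10 \<le> N" and k: "22 * (N - R 10) + 20 \<le> k"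
    and win: "\<And>t. R 8 + t < R 10 \<Longrightarrow> letter M t = letter M (R 8 + t)"
    and post: "\<And>R' k'. same_params R' R \<Longrightarrow> R' 8 = R 8 \<Longrightarrow> R 10 \<le> R' 10 \<Longrightarrow> R' 10 \<le> N \<Longrightarrow>
       is_lce (letter M) N (R 8) (R' 10 - R 8) \<Longrightarrow> 
       k + 22 * R 10 \<le> k' + 22 * R' 10 + 20 \<Longrightarrow> U R' M k'"
  shows "wp w extension_loop U R M k"
  unfolding extension_loop_def
proof (rule wp_Loop[where I = "\<lambda>R' M' k'. M' = M \<and> same_params R' R \<and> R' 8 = R 8 \<and>
    R 10 \<le> R' 10 \<and> R' 10 \<le> N \<and> (\<forall>t. R 8 + t < R' 10 \<longrightarrow> letter M t = letter M (R 8 + t)) \<and>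
    k + 22 * R 10 \<le> k' + 22 * R' 10"], goal_cases)
  case (1 R' M' k')
  note inv = 1
  have par': "params R'" using inv par params_cong by blast
  have k': "k' \<ge> 22 * (N - R' 10) + 20" using inv k le by linarith
  show ?case
  proof (rule wp_extension_cond[OF par'], goal_cases)
    case (4 R2)
    have sp: "same_params R2 R" using 4 inv same_params_trans by blast
    have par2: "params R2" using 4(1) par' params_cong by blast
    show ?case
    proof (cases "R2 14 = 0")
      case True
      have "is_lce (letter M) N (R 8) (R2 10 - R 8)"
        using inv 4 True le unfolding is_lce_def by auto
      hence "U R2 M (k' - 19 - 1)" using inv 4 sp le k' by (intro post) auto
      thus ?thesis using True inv k' by simp
    next
      case False
      hence more: "R' 10 < N" "letter M (R' 10) = letter M (R' 10 - R 8)" using 4 inv by auto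
      have ext: "letter M t = letter M (R 8 + t)" if "R 8 + t < R2 10 + 1" for t
      proof (cases "R 8 + t = R' 10")
        case True
        thus ?thesis using more by (metis diff_add_inverse)
      next
        case False
        thus ?thesis using that inv 4 by auto
      qed
      have R2: "R2 3 = 1" "R2 8 = R 8" "R2 10 = R' 10"
        using par2 4 inv by (simp_all add: params_def)
      show ?thesis
      proof (simp only: False if_False, intro conjI wp_Basic[where n = 1], goal_cases)
        case 4
        show ?case using R2 sp inv le k' more word_size ext by simp
      qed (use more k' in auto)
    qed
  qed (use inv le k' in auto)
qed (use assms in auto)

text \<open>Register 8 may reach \<open>N + 1\<close> because the table includes position
  \<open>N\<close>: the candidate period equal to the full dimension reads that entry.\<close>

definition lce_inv :: "store \<Rightarrow> store \<Rightarrow> store \<Rightarrow> bool" where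
  "lce_inv M R M' \<longleftrightarrow> 1 \<le> R 8 \<and> R 8 \<le> N + 1 \<and> 1 \<le> R 9 \<and> R 9 \<le> R 8 \<and> R 10 \<le> N \<and>
     (\<forall>t. R 9 + t < R 10 \<longrightarrow> letter M t = letter M (R 9 + t)) \<and>
     (\<forall>a<N. M' a = M a) \<and> (\<forall>j<R 8. is_lce (letter M) N j (M' (N + j)))"

lemma wp_lce_body:
  assumes par: "params R" and inv: "lce_inv M R M'" and le: "R 8 \<le> N"
    and k: "22 * (N - R 10) + 40 \<le> k"
    and post: "\<And>R' M'' k'. same_params R' R \<Longrightarrow> R' 8 = R 8 + 1 \<Longrightarrow> lce_inv M R' M'' \<Longrightarrow>
       k + 22 * R 10 \<le> k' + 22 * R' 10 + 37 \<Longrightarrow> U R' M'' k'"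
  shows "wp w lce_body U R M' k"
proof -
  define z where "z = M' (N + (R 8 - R 9))"
  have R: "R 2 = N" "R 3 = 1" "R 9 \<ge> 1" "R 8 \<ge> 1" "R 9 \<le> R 8" "R 10 \<le> N"
    and win: "\<And>t. R 9 + t < R 10 \<Longrightarrow> letter M t = letter M (R 9 + t)"
    and M': "\<And>a. a < N \<Longrightarrow> M' a = M a"
    and tab: "\<And>j. j < R 8 \<Longrightarrow> is_lce (letter M) N j (M' (N + j))"
    using par inv by (auto simp: params_def lce_inv_def)
  have z: "is_lce (letter M) N (R 8 - R 9) z" unfolding z_def using tab[of "R 8 - R 9"] R by simp
  have zN: "z \<le> N" using z unfolding is_lce_def by simp
  have letter: "letter M' j = letter M j" if "j < N" for j using letter_cong[OF M' that] by simp
  \<comment> \<open>Assertion where the branches join: register 12 holds the extension at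
    \<open>R 8\<close>, and three credits remain for storing it and advancing.\<close>
  define V where "V R' M2 k' \<longleftrightarrow> same_params R' R \<and> M2 = M' \<and> R' 8 = R 8 \<and> 1 \<le> R' 9 \<and> R' 9 \<le> R 8 \<and>
    R' 10 \<le> N \<and> (\<forall>t. R' 9 + t < R' 10 \<longrightarrow> letter M t = letter M (R' 9 + t)) \<and>
    is_lce (letter M) N (R 8) (R' 12) \<and> 3 \<le> k' \<and> k + 22 * R 10 \<le> k' + 22 * R' 10 + 34" for R' M2 k'
  let ?R1 = "R(12 := z, 13 := R 10 - (R 8 + z))"
  have branch: "wp w (Cond 13 (Basic [])
       (Basic [Sub 10 10 8, Add 10 10 8] ;; extension_loop ;;
        Basic [Sub 12 10 8, Const 13 0, Add 9 8 13])) V ?R1 M' (k - 5)"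
  proof (rule wp_Cond, goal_cases)
    case 1 show ?case using k by simp
  next
    case 2
    hence "is_lce (letter M) N (R 8) z"
      by (intro is_lce_shift[OF win _ _ z]) (use R in auto)
    thus ?case using R k win by (intro wp_Basic[where n = 0]) (auto simp: V_def)
  next
    case 3
    let ?q = "R 10 - R 8 + R 8"
    have q: "?q \<le> N" "R 8 \<le> ?q" using R le by auto
    have ext: "letter M' t = letter M' (R 8 + t)" if "R 8 + t < ?q" for t
    proof -
      have "letter M t = letter M (R 8 + t)"
        by (rule is_lce_window[OF win R(5) z]) (use 3 that in auto)
      thus ?thesis using that q letter by simp
    qed
    have fitq: "?q < 2 ^ w" "R 8 < 2 ^ w" using q word_size by linarith+
    have "wp w (extension_loop ;; Basic [Sub 12 10 8, Const 13 0, Add 9 8 13]) V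
        (?R1(10 := ?q)) M' (k - 6 - 2)"
    proof (intro wp_Seq wp_extension_loop, goal_cases)
      case (6 R' k')
      have lce: "is_lce (letter M) N (R 8) (R' 10 - R 8)"
        using 6(5) is_lce_cong[of N "letter M'" "letter M"] letter by simp
      have win': "letter M t = letter M (R 8 + t)" if "R 8 + t < R' 10" for t
        using lce that unfolding is_lce_def by auto
      have sp: "same_params R' R" using 6(1) by simp
      have "k \<ge> 22 * (N - ?q) + 40" using k by auto
      hence k': "k' \<ge> 10" "k + 22 * R 10 \<le> k' + 22 * R' 10 + 28" using 6(4,6) q by auto
      show ?case
        by (rule wp_Basic[where n = 3])
          (use 6 R lce win' sp k' fitq q in \<open>auto simp: V_def\<close>)
    next
      case 1 show ?case using par by (simp add: params_def)
    next
      case 4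
      show ?case using k q by auto
    qed (use q ext in auto)
    thus ?case using R k fitq by (intro wp_Seq wp_Basic[where n = 2]) auto
  qed
  have final: "wp w (Basic [Add 13 2 8, Store 13 12, Add 8 8 3]) U R' M2 k'"
    if V: "V R' M2 k'" for R' M2 k'
  proof (rule wp_Basic[where n = 3], goal_cases)
    case 3
    note V' = V[unfolded V_def]
    have R': "R' 2 = N" "R' 3 = 1" "R' 8 = R 8" "M2 = M'"
      using V' R by (auto simp: same_params_def)
    let ?R = "R'(13 := N + R 8, 8 := R 8 + 1)" and ?M = "M'(N + R 8 := R' 12)"
    have "lce_inv M ?R ?M"
      unfolding lce_inv_def using V' R le M' tab by (auto simp: less_Suc_eq)
    hence "U ?R ?M (k' - 3)" using V' by (intro post) auto
    thus ?case using R' le word_size R by simp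
  qed (use V in \<open>auto simp: V_def\<close>)
  have start: "wp_instrs w [Sub 12 8 9, Add 12 2 12, Load 12 12, Add 13 8 12, Sub 13 10 13]
      (\<lambda>R2 M2. wp w (Cond 13 (Basic [])
       (Basic [Sub 10 10 8, Add 10 10 8] ;; extension_loop ;;
        Basic [Sub 12 10 8, Const 13 0, Add 9 8 13])) V R2 M2 (k - 5)) R M'"
  proof -
    have "M' (N + R 8 - R 9) = z" using R(5) by (simp add: z_def)
    moreover have "N + R 8 - R 9 < 2 ^ w" "R 8 + z < 2 ^ w" using le zN word_size by linarith+
    ultimately show ?thesis using R branch by simp
  qed
  show ?thesis unfolding lce_body_def
    by (rule wp_Seq, rule wp_Basic[where n = 5], simp, use k in simp, rule wp_instrs_mono[OF start],
        rule wp_Seq, erule wp_mono, rule final)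
qed

lemma wp_lce_table:
  assumes par: "params R" and k: "72 * N \<le> k"
    and post: "\<And>R' M' k'. same_params R' R \<Longrightarrow> (\<And>a. a < N \<Longrightarrow> M' a = M a) \<Longrightarrow>
       (\<And>j. j \<le> N \<Longrightarrow> is_lce (letter M) N j (M' (N + j))) \<Longrightarrow> k \<le> k' + 72 * N \<Longrightarrow> U R' M' k'"
  shows "wp w lce_table U R M k"
proof -
  have kN: "64 * N + 8 \<le> k" using k N_pos by linarith
  have R: "R 2 = N" "R 3 = 1" using par by (auto simp: params_def)
  \<comment> \<open>Each position is charged 42: at most 37 for the body outside the potential, and
    4 for the loop test and its jumps. Register 8 starts at 1 after 4 steps, whence
    \<open>38 = 42 - 4\<close>.\<close>
  let ?I = "\<lambda>R' M' k'. same_params R' R \<and> lce_inv M R' M' \<and> k + 38 \<le> k' + 42 * R' 8 + 22 * R' 10"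
  have loop: "wp w (Loop (Basic [Add 12 2 3, Sub 12 12 8]) 12 lce_body) U R0 M0 k0"
    if "?I R0 M0 k0" for R0 M0 k0
  proof (rule wp_Loop[where I = ?I, OF _ that])
    fix R' M' k' assume I: "?I R' M' k'"
    have R': "R' 2 = N" "R' 3 = 1" using I R by (simp_all add: same_params_def)
    have b: "R' 10 \<le> N" "R' 8 \<le> N + 1" using I by (auto simp: lce_inv_def)
    let ?R = "R'(12 := N + 1 - R' 8)"
    have par': "params ?R" using I par params_cong[of ?R R] by simp
    have inv': "lce_inv M ?R M'" using I by (simp add: lce_inv_def)
    have "U ?R M' (k' - 3)" if "R' 8 = N + 1"
      using I b that kN N_pos by (intro post) (auto simp: lce_inv_def)
    moreover have "wp w lce_body (\<lambda>R M k. 1 \<le> k \<and> ?I R M (k - 1)) ?R M' (k' - 3)" if "R' 8 \<le> N"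
    proof (rule wp_lce_body[OF par' inv'], goal_cases)
      case (3 R2 M2 k2)
      have "same_params R2 R" using 3(1) I by (auto intro: same_params_trans)
      moreover have "1 \<le> k2"
        using I 3 kN that b by (auto simp: lce_inv_def)
      ultimately show ?case using 3 I kN that b by auto
    qed (use I b that kN in auto)
    ultimately show "wp w (Basic [Add 12 2 3, Sub 12 12 8])
       (\<lambda>R M k. 1 \<le> k \<and> (if R 12 = 0 then U R M (k - 1)
          else wp w lce_body (\<lambda>R M k. 1 \<le> k \<and> ?I R M (k - 1)) R M (k - 1))) R' M' k'"
      using I b kN R' word_size N_pos by (intro wp_Basic[where n = 2]) (auto simp: not_le le_Suc_eq)
  qed
  have "wp w (Loop (Basic [Add 12 2 3, Sub 12 12 8]) 12 lce_body) U
      (R(8 := 1, 9 := 1, 10 := 0)) (M(N := N)) (k - 4)"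
    by (rule loop) (use is_lce_0[of "letter M" N] kN in \<open>auto simp: lce_inv_def\<close>)
  thus ?thesis unfolding lce_table_def
    using kN R word_size N_pos by (intro wp_Seq wp_Basic[where n = 4]) auto
qed

lemma wp_period_search:
  assumes par: "params R" and R: "R 6 = m" "R 7 = n" and mn: "m * n = N" and k: "15 * m \<le> k"
    and tab: "\<And>j. j \<le> N \<Longrightarrow> is_lce x N j (M (N + j))"
    and post: "\<And>R' k'. same_params R' R \<Longrightarrow>
       R' 11 = (LEAST d. 0 < d \<and> d dvd m \<and> (\<forall>t. d * n + t < N \<longrightarrow> x t = x (d * n + t))) \<Longrightarrow>
       k \<le> k' + 15 * m \<Longrightarrow> U R' M k'"
  shows "wp w period_search U R M k"
proof -
  have pos: "0 < m" "0 < n" using mn N_pos by (auto intro: Nat.gr0I)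
  have R23: "R 2 = N" "R 3 = 1" using par by (auto simp: params_def)
  define good where "good d \<longleftrightarrow> 0 < d \<and> d dvd m \<and> (\<forall>t. d * n + t < N \<longrightarrow> x t = x (d * n + t))" for d
  \<comment> \<open>A rejected candidate costs 12: nine test instructions, two jumps and the
    increment.\<close>
  let ?I = "\<lambda>R' M' k'. same_params R' R \<and> M' = M \<and> 1 \<le> R' 11 \<and> R' 11 \<le> m \<and>
     (\<forall>d<R' 11. \<not> good d) \<and> k + 11 \<le> k' + 12 * R' 11"
  have loop: "wp w (Loop (Basic period_test) 12 (Basic [Add 11 11 3])) U R0 M0 k0"
    if "?I R0 M0 k0" for R0 M0 k0
  proof (rule wp_Loop[where I = ?I, OF _ that])
    fix R' M' k' assume I: "?I R' M' k'"
    define d where "d = R' 11"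
    have R': "R' 2 = N" "R' 3 = 1" "R' 6 = m" "R' 7 = n"
      using I R R23 by (simp_all add: same_params_def)
    have d: "1 \<le> d" "d \<le> m" using I by (auto simp: d_def)
    have dn: "d * n \<le> N" unfolding mn[symmetric] using d by simp
    have mN: "m \<le> N" using mn pos by (metis Suc_leI mult.right_neutral mult_le_mono2 One_nat_def)
    define z where "z = M (N + d * n)"
    have z: "is_lce x N (d * n) z" unfolding z_def by (rule tab[OF dn])
    have zN: "z \<le> N - d * n" using z unfolding is_lce_def by linarith
    have flag: "m mod d + (N - d * n - z) = 0 \<longleftrightarrow> good d"
      using is_lce_maximal_iff[OF z] zN d by (auto simp: good_def dvd_eq_mod_eq_0)
    \<comment> \<open>The search stops at \<open>m\<close> at the latest: a shift by
      \<open>m * n = N\<close> leaves no letters to compare.\<close>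
    have good_m: "good m" using pos mn by (simp add: good_def)
    let ?R = "R'(13 := z, 14 := N - d * n - z, 12 := m mod d + (N - d * n - z))"
    have fit: "m div d * d < 2 ^ w" "m mod d + (N - d * n - z) < 2 ^ w" "d * n < 2 ^ w"
      "N + d * n < 2 ^ w" "d + 1 < 2 ^ w"
    proof -
      have "m div d * d \<le> m" "m mod d \<le> m" by simp_all
      thus "m div d * d < 2 ^ w" "m mod d + (N - d * n - z) < 2 ^ w" "d * n < 2 ^ w"
        "N + d * n < 2 ^ w" using mN dn word_size by linarith+
      show "d + 1 < 2 ^ w" using d mN word_size N_pos by linarith
    qed
    have exit: "U ?R M (k' - 10)" if "good d"
    proof (rule post)
      have "d = (LEAST d. good d)"
        using that I by (intro Least_equality[symmetric]) (auto simp: d_def not_less[symmetric])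
      thus "?R 11 = (LEAST d. 0 < d \<and> d dvd m \<and> (\<forall>t. d * n + t < N \<longrightarrow> x t = x (d * n + t)))"
        by (simp add: d_def good_def)
    qed (use I d pos k in \<open>auto simp: d_def\<close>)
    have next_d: "wp w (Basic [Add 11 11 3]) (\<lambda>R M k. 1 \<le> k \<and> ?I R M (k - 1)) ?R M (k' - 10)"
      if "\<not> good d"
    proof -
      have "d < m" using that good_m d by (cases "d = m") auto
      thus ?thesis using I that k d fit R'
        by (intro wp_Basic[where n = 1]) (auto simp: d_def less_Suc_eq)
    qed
    have k': "10 \<le> k'" using I k d pos by (auto simp: d_def)
    have st: "wp_instrs w period_test (\<lambda>R2 M2. R2 = ?R \<and> M2 = M) R' M"
      using fit R' by (auto simp: d_def[symmetric] z_def[symmetric] minus_div_mult_eq_mod)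
    have target: "1 \<le> k' - 9 \<and> (if ?R 12 = 0 then U ?R M (k' - 9 - 1)
        else wp w (Basic [Add 11 11 3]) (\<lambda>R M k. 1 \<le> k \<and> ?I R M (k - 1)) ?R M (k' - 9 - 1))"
    proof (cases "good d")
      case True
      thus ?thesis using exit flag k' by simp
    next
      case False
      have "?R 12 \<noteq> 0" using False flag by simp
      thus ?thesis using next_d[OF False] k' by (simp only: if_False diff_diff_left) simp
    qed
    have "M' = M" using I by simp
    show "wp w (Basic period_test)
       (\<lambda>R M k. 1 \<le> k \<and> (if R 12 = 0 then U R M (k - 1)
          else wp w (Basic [Add 11 11 3]) (\<lambda>R M k. 1 \<le> k \<and> ?I R M (k - 1)) R M (k - 1))) R' M' k'"
      unfolding \<open>M' = M\<close>
      by (rule wp_Basic[where n = 9], simp, use k' in simp, rule wp_instrs_mono[OF st],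
          erule conjE, hypsubst, rule target)
  qed
  have "wp w (Loop (Basic period_test) 12 (Basic [Add 11 11 3])) U
       (R(11 := 1)) M (k - 1)"
    by (rule loop) (use pos k in \<open>auto simp: good_def\<close>)
  thus ?thesis unfolding period_search_def
    using k pos word_size N_pos by (intro wp_Seq wp_Basic[where n = 1]) auto
qed

lemma wp_least_period:
  assumes par: "params R" and R: "R 6 = m" "R 7 = n" and mn: "m * n = N" and k: "87 * N \<le> k"
    and post: "\<And>R' M' k'. same_params R' R \<Longrightarrow> (\<And>a. a < N \<Longrightarrow> M' a = M a) \<Longrightarrow>
       R' 11 = (LEAST d. 0 < d \<and> d dvd m \<and>
                  (\<forall>t. d * n + t < N \<longrightarrow> letter M t = letter M (d * n + t))) \<Longrightarrow>
       k \<le> k' + 87 * N \<Longrightarrow> U R' M' k'"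
  shows "wp w (lce_table ;; period_search) U R M k"
proof (rule wp_Seq, rule wp_lce_table[OF par], goal_cases)
  case 1
  show ?case using k by simp
next
  case (2 R' M' k')
  have "0 < n" using mn N_pos by (auto intro: Nat.gr0I)
  hence mN: "m \<le> N" using mn by auto
  have par': "params R'" using 2(1) par params_cong by blast
  have R': "R' 6 = m" "R' 7 = n" using 2(1) R by (simp_all add: same_params_def)
  have k': "15 * m \<le> k'" using mN 2(4) k by linarith
  show ?case
  proof (rule wp_period_search[OF par' R' mn k' 2(3)], goal_cases)
    case (2 R2 k2)
    thus ?case using \<open>same_params R' R\<close> \<open>k \<le> k' + 72 * N\<close> mN \<open>\<And>a. a < N \<Longrightarrow> M' a = M a\<close>
      by (intro post) (auto intro: same_params_trans)
  qed
qed

end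


section \<open>Periods and primitive roots of arrays\<close>

text \<open>Divisibility is part of the notion because a mere shift period may leave an incomplete
  block at the bottom.\<close>

definition row_period :: "'a mat \<Rightarrow> nat \<Rightarrow> bool" where
  "row_period A d \<longleftrightarrow> 0 < d \<and> d dvd dim_row A \<and>
     (\<forall>i j. d + i < dim_row A \<longrightarrow> j < dim_col A \<longrightarrow> A $$ (i, j) = A $$ (d + i, j))"

lemma row_period_dim_row: "dim_row A > 0 \<Longrightarrow> row_period A (dim_row A)"
  by (simp add: row_period_def)

lemma row_period_mod:
  assumes "row_period A d" "i < dim_row A" "j < dim_col A"
  shows "A $$ (i, j) = A $$ (i mod d, j)"
  using assms(2)
proof (induction i rule: less_induct)
  case (less i)
  show ?case
  proof (cases "i < d")
    case False
    hence "A $$ (i - d, j) = A $$ (i, j)"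
      using assms less.prems unfolding row_period_def by (metis le_add_diff_inverse not_less)
    moreover have "A $$ (i - d, j) = A $$ ((i - d) mod d, j)"
      using less False assms(1) by (auto simp: row_period_def)
    ultimately show ?thesis using False by (simp add: le_mod_geq)
  qed simp
qed

lemma row_period_array_power:
  assumes "A = array_power B p q" "nonempty_array A"
  shows "row_period A (dim_row B)"
  using assms by (auto simp: row_period_def nonempty_array_def)

definition least_row_period :: "'a mat \<Rightarrow> nat" where
  "least_row_period A = (LEAST d. row_period A d)"

lemma least_row_period:
  assumes "nonempty_array A"
  shows "row_period A (least_row_period A)" "0 < least_row_period A"
    "least_row_period A dvd dim_row A" "least_row_period A \<le> dim_row A"
proof -
  show 1: "row_period A (least_row_period A)" unfolding least_row_period_def
    by (rule LeastI) (use assms in \<open>auto intro: row_period_dim_row simp: nonempty_array_def\<close>)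
  thus "0 < least_row_period A" "least_row_period A dvd dim_row A" by (simp_all add: row_period_def)
  thus "least_row_period A \<le> dim_row A" using assms by (auto simp: nonempty_array_def dvd_imp_le)
qed

lemma nonempty_array_transpose: "nonempty_array A \<Longrightarrow> nonempty_array (transpose_mat A)"
  by (simp add: nonempty_array_def)

definition corner :: "'a mat \<Rightarrow> 'a mat" where
  "corner A = mat (least_row_period A) (least_row_period (transpose_mat A)) (\<lambda>(i, j). A $$ (i, j))"

lemma array_power_corner:
  assumes "nonempty_array A"
  shows "\<exists>p q. p > 0 \<and> q > 0 \<and> A = array_power (corner A) p q"
proof -
  define r c where "r = least_row_period A" and "c = least_row_period (transpose_mat A)"
  note r = least_row_period[OF assms, folded r_def]
  note c = least_row_period[OF nonempty_array_transpose[OF assms], folded c_def]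
  obtain p where p: "dim_row A = r * p" using r(3) by blast
  obtain q where q: "dim_col A = c * q" using c(3) by auto
  have pq: "p > 0" "q > 0" using p q assms by (auto simp: nonempty_array_def intro: Nat.gr0I)
  have "A = array_power (corner A) p q"
  proof (rule eq_matI, goal_cases)
    case (1 i j)
    hence ij: "i < dim_row A" "j < dim_col A" "i < p * r" "j < q * c"
      by (simp_all add: p q corner_def r_def[symmetric] c_def[symmetric] mult.commute)
    have ir: "i mod r < r" "j mod c < c" using r(2) c(2) by simp_all
    hence ir': "i mod r < dim_row A" using r(4) by linarith
    have jc: "j mod c < dim_col A" using ij(2) by (meson le_less_trans mod_less_eq_dividend)
    have "A $$ (i, j) = A $$ (i mod r, j)" using row_period_mod[OF r(1) ij(1,2)] .
    also have "\<dots> = A $$ (i mod r, j mod c)"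
      using row_period_mod[OF c(1), of j "i mod r"] ij ir' jc by simp
    finally show ?case using ij ir
      by (simp add: corner_def r_def[symmetric] c_def[symmetric])
  qed (simp_all add: p q corner_def r_def c_def)
  thus ?thesis using pq by blast
qed

text \<open>If the corner is a power of \<open>B\<close>, then so is \<open>A\<close>, and the
  height of \<open>B\<close> is a row period of \<open>A\<close>. Minimality forbids it to be
  smaller than the corner's height; transposition gives the same for widths.\<close>

lemma primitive_corner:
  assumes "nonempty_array A"
  shows "primitive_array (corner A)"
proof -
  note r = least_row_period[OF assms]
  note c = least_row_period[OF nonempty_array_transpose[OF assms]]
  obtain i j where ij: "i > 0" "j > 0" "A = array_power (corner A) i j"
    using array_power_corner[OF assms] by blast
  have dim: "dim_row (corner A) = least_row_period A"
    "dim_col (corner A) = least_row_period (transpose_mat A)" by (simp_all add: corner_def)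
  show ?thesis unfolding primitive_array_def
  proof (intro conjI allI impI)
    show "nonempty_array (corner A)" using r c dim by (simp add: nonempty_array_def)
    fix B p q assume pq: "0 < (p::nat)" "0 < (q::nat)" "corner A = array_power B p q"
    have A: "A = array_power B (i * p) (j * q)"
      using ij(3) pq(3) array_power_array_power[of B p q i j] by simp
    have "row_period A (dim_row B)" using row_period_array_power[OF A assms] .
    hence "least_row_period A \<le> dim_row B" unfolding least_row_period_def by (rule Least_le)
    moreover have "p * dim_row B = least_row_period A" using dim pq by simp
    ultimately have "p * dim_row B \<le> 1 * dim_row B" "0 < dim_row B"
      using r(2) by (auto intro: Nat.gr0I)
    thus "p = 1" using pq by simp
    have "transpose_mat A = array_power (transpose_mat B) (j * q) (i * p)"
      using arg_cong[OF A, of transpose_mat] transpose_array_power by metis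
    hence "row_period (transpose_mat A) (dim_row (transpose_mat B))"
      by (rule row_period_array_power[OF _ nonempty_array_transpose[OF assms]])
    hence "least_row_period (transpose_mat A) \<le> dim_col B"
      unfolding least_row_period_def by (auto intro: Least_le)
    moreover have "q * dim_col B = least_row_period (transpose_mat A)" using dim pq by simp
    ultimately have "q * dim_col B \<le> 1 * dim_col B" "0 < dim_col B"
      using c(2) by (auto intro: Nat.gr0I)
    thus "q = 1" using pq by simp
  qed
qed

lemma primitive_root_eq_corner:
  assumes "nonempty_array A"
  shows "primitive_root A = corner A"
  unfolding primitive_root_def
  by (rule the1_equality[OF primitive_root_ex1[OF assms]])
    (use primitive_corner array_power_corner assms in blast)

lemma primitive_array_iff_periods:
  assumes "nonempty_array A"
  shows "primitive_array A \<longleftrightarrow>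
    least_row_period A = dim_row A \<and> least_row_period (transpose_mat A) = dim_col A"
proof
  assume "primitive_array A"
  hence "primitive_root A = A" unfolding primitive_root_def
    by (intro the1_equality[OF primitive_root_ex1[OF assms]])
      (metis array_power_1_1 zero_less_Suc)
  hence "corner A = A" using primitive_root_eq_corner[OF assms] by simp
  thus "least_row_period A = dim_row A \<and> least_row_period (transpose_mat A) = dim_col A"
    unfolding corner_def by (metis dim_row_mat(1) dim_col_mat(1))
next
  assume "least_row_period A = dim_row A \<and> least_row_period (transpose_mat A) = dim_col A"
  hence "corner A = A" unfolding corner_def by (intro eq_matI) auto
  thus "primitive_array A" using primitive_corner[OF assms] by simp
qed

text \<open>Moving down \<open>d\<close> rows moves \<open>d * n\<close> places in row-major order.
  Injectivity of \<open>code\<close> on the entries turns equal numbers back into equal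
  letters.\<close>

lemma row_period_iff_shift:
  assumes A: "A \<in> carrier_mat m n" "0 < n" and inj: "inj_on code (elements_mat A)"
    and x: "\<And>k. k < m * n \<Longrightarrow> x k = code (A $$ (k div n, k mod n))"
  shows "0 < d \<and> d dvd m \<and> (\<forall>t. d * n + t < m * n \<longrightarrow> x t = x (d * n + t)) \<longleftrightarrow> row_period A d"
proof -
  have inj': "code (A $$ (i, j)) = code (A $$ (i', j')) \<longleftrightarrow> A $$ (i, j) = A $$ (i', j')"
    if "i < m" "i' < m" "j < n" "j' < n" for i i' j j'
    using inj that A(1) by (intro inj_on_eq_iff[OF inj]) auto
  have "(\<forall>t. d * n + t < m * n \<longrightarrow> x t = x (d * n + t)) \<longleftrightarrow>
        (\<forall>i j. d + i < m \<longrightarrow> j < n \<longrightarrow> A $$ (i, j) = A $$ (d + i, j))"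
  proof (intro iffI allI impI)
    fix i j assume *: "\<forall>t. d * n + t < m * n \<longrightarrow> x t = x (d * n + t)" and ij: "d + i < m" "j < n"
    have "(d + i) * n + j < (d + i + 1) * n" using ij by simp
    also have "\<dots> \<le> m * n" using ij by (intro mult_le_mono1) simp
    finally have lt: "d * n + (i * n + j) < m * n" by (simp add: algebra_simps)
    have "(d * n + (i * n + j)) div n = d + i" "(d * n + (i * n + j)) mod n = j"
      using ij A(2) by (simp_all add: add.assoc[symmetric] add_mult_distrib[symmetric])
    moreover have "(i * n + j) div n = i" "(i * n + j) mod n = j" using ij by simp_all
    ultimately have "code (A $$ (i, j)) = code (A $$ (d + i, j))"
      using * lt x[of "i * n + j"] x[OF lt] by (simp del: div_mult_self3 mod_mult_self3)
    thus "A $$ (i, j) = A $$ (d + i, j)" using inj' ij by simp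
  next
    fix t assume *: "\<forall>i j. d + i < m \<longrightarrow> j < n \<longrightarrow> A $$ (i, j) = A $$ (d + i, j)"
      and t: "d * n + t < m * n"
    have "(d * n + t) div n = d + t div n" "(d * n + t) mod n = t mod n" using A(2) by simp_all
    moreover from this(1) have "d + t div n < m" using t by (metis less_mult_imp_div_less)
    ultimately show "x t = x (d * n + t)" using * t x[of t] x[OF t] A(2) by simp
  qed
  thus ?thesis using A(1) by (auto simp: row_period_def)
qed


section \<open>The program\<close>

abbreviation copy_letter :: "instr list" where
  "copy_letter \<equiv>
     [Div 12 8 11, Mul 13 12 11, Sub 13 8 13, Mul 12 12 1, Add 12 12 13, Load 12 12, Store 8 12,
      Add 8 8 3]"

text \<open>
  The copy is in place; it is sound because the target address \<open>a\<close> never exceeds the source address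
  \<open>(a div c) * n + a mod c\<close>.
\<close>

definition copy_corner :: com where
  "copy_corner =
     Basic [Mul 21 20 11, Const 8 0] ;;
     Loop (Basic [Sub 12 21 8]) 12
       (Basic copy_letter)"

abbreviation write_output :: "instr list" where
  "write_output \<equiv>
     [Sub 12 2 21, Sub 0 3 12, Const 12 0, Add 1 20 12, Add 2 11 12]"

text \<open>The second search sees the \<open>n\<close> by \<open>m\<close> transpose through
  another address map, without moving any data. Register 20 saves the row period before register 11
  is reused.\<close>

abbreviation select_columns :: "instr list" where
  "select_columns \<equiv>
     [Const 12 0, Add 20 11 12, Add 4 0 12, Add 5 1 12, Add 6 1 12, Add 7 0 12]"

definition root_program :: com where
  "root_program =
     Basic [Const 3 1, Mul 2 0 1, Const 12 0, Add 4 2 12, Const 5 1, Add 6 0 12, Add 7 1 12] ;;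
     (lce_table ;; period_search) ;;
     Basic select_columns ;;
     (lce_table ;; period_search) ;;
     copy_corner ;;
     Basic write_output"

section \<open>Correctness and cost of the whole program\<close>

lemma corner_address_less:
  assumes "b < r * c" "r \<le> m" "0 < c" "c \<le> (n :: nat)"
  shows "(b div c) * n + b mod c < m * n"
proof -
  have "b div c < r" using assms(1) by (metis less_mult_imp_div_less)
  hence "(b div c + 1) * n \<le> m * n" using assms(2) by (intro mult_le_mono1) simp
  moreover have "b mod c < n" using assms(3,4) by (meson less_le_trans mod_less_divisor)
  ultimately show ?thesis by simp
qed

lemma wp_copy_corner:
  assumes R: "R 1 = n" "R 3 = 1" "R 11 = c" "R 20 = r"
    and c: "0 < c" "c \<le> n" and r: "r \<le> m" and N: "0 < m * n" "2 * (m * n) < 2 ^ w"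
    and k: "20 * (m * n) \<le> k"
    and post: "\<And>R' M' k'. R' 2 = R 2 \<Longrightarrow> R' 3 = 1 \<Longrightarrow> R' 11 = c \<Longrightarrow> R' 20 = r \<Longrightarrow> R' 21 = r * c \<Longrightarrow>
      (\<And>b. b < r * c \<Longrightarrow> M' b = M ((b div c) * n + b mod c)) \<Longrightarrow> k \<le> k' + 20 * (m * n) \<Longrightarrow> U R' M' k'"
  shows "wp w copy_corner U R M k"
proof -
  have rc: "r * c \<le> m * n" using r c by (intro mult_le_mono) auto
  \<comment> \<open>Cells from register 8 on are still original. A copied letter costs 11: eight
    instructions, the loop test and two jumps.\<close>
  let ?I = "\<lambda>(R' :: store) (M' :: store) k'.
    R' 1 = n \<and> R' 2 = R 2 \<and> R' 3 = 1 \<and> R' 11 = c \<and> R' 20 = r \<and> R' 21 = r * c \<and>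
    R' 8 \<le> r * c \<and> (\<forall>b. R' 8 \<le> b \<longrightarrow> M' b = M b) \<and>
    (\<forall>b<R' 8. M' b = M ((b div c) * n + b mod c)) \<and> k \<le> k' + 11 * R' 8 + 2"
  have loop: "wp w (Loop (Basic [Sub 12 21 8]) 12
       (Basic copy_letter)) U R0 M0 k0"
    if "?I R0 M0 k0" for R0 M0 k0
  proof (rule wp_Loop[where I = ?I, OF _ that])
    fix R' M' k' assume I: "?I R' M' k'"
    define a where "a = R' 8"
    have k': "7 \<le> k'" using I k rc N by linarith
    have exit: "U (R'(12 := 0)) M' (k' - 2)" if "a = r * c"
    proof -
      have "k \<le> k' - 2 + 20 * (m * n)" using I that rc N k' unfolding a_def by linarith
      thus ?thesis using I that by (intro post) (simp_all add: a_def)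
    qed
    have step: "wp w (Basic copy_letter) (\<lambda>R M k. 1 \<le> k \<and> ?I R M (k - 1))
        (R'(12 := r * c - a)) M' (k' - 2)"
      if less: "a < r * c"
    proof -
      define ad where "ad = (a div c) * n + a mod c"
      have adN: "ad < m * n" unfolding ad_def by (rule corner_address_less[OF less r c])
      have "a = (a div c) * c + a mod c" by simp
      also have "\<dots> \<le> ad" unfolding ad_def by (intro add_le_mono1 mult_le_mono2 c)
      finally have "a \<le> ad" .
      hence load: "M' ad = M ad" using I by (simp add: a_def)
      have "(a div c) * c \<le> a" by simp
      hence fit: "(a div c) * c < 2 ^ w" "(a div c) * n < 2 ^ w" "ad < 2 ^ w" "a + 1 < 2 ^ w"
        using less rc N adN unfolding ad_def by linarith+
      have k'': "15 \<le> k'" using I k rc N less by (simp add: a_def)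
      show ?thesis
        by (rule wp_Basic[where n = 8])
          (use I fit load k'' less in \<open>auto simp: a_def[symmetric]
             minus_div_mult_eq_mod ad_def[symmetric] less_Suc_eq\<close>)
    qed
    show "wp w (Basic [Sub 12 21 8]) (\<lambda>R M k. 1 \<le> k \<and> (if R 12 = 0 then U R M (k - 1)
          else wp w (Basic copy_letter) (\<lambda>R M k. 1 \<le> k \<and> ?I R M (k - 1)) R M (k - 1))) R' M' k'"
    proof (rule wp_Basic[where n = 1], goal_cases)
      case 3
      have R': "R' 21 - R' 8 = r * c - a" using I by (simp add: a_def)
      have "a = r * c \<or> a < r * c" using I by (auto simp: a_def)
      thus ?case
      proof
        assume "a = r * c"
        thus ?thesis using exit k' R' by (simp add: numeral_2_eq_2)
      next
        assume less: "a < r * c"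
        show ?thesis using less k' step[OF less]
          by (simp only: wp_instrs.simps R' fun_upd_same diff_diff_left) (simp add: numeral_2_eq_2)
      qed
    qed (use k' in auto)
  qed
  have "wp w (Loop (Basic [Sub 12 21 8]) 12
       (Basic copy_letter)) U (R(21 := r * c, 8 := 0)) M (k - 2)"
    by (rule loop) (use R in auto)
  moreover have "2 \<le> k" "r * c < 2 ^ w" "(0 :: nat) < 2 ^ w" using k rc N by linarith+
  ultimately show ?thesis unfolding copy_corner_def
    using R by (intro wp_Seq wp_Basic[where n = 2]) auto
qed

lemma string_view_rows:
  assumes "0 < N" "2 * N < 2 ^ w"
  shows "string_view w N N 1"
proof
  fix k :: nat
  show "k mod N * 1 + k div N \<le> N" if "k \<le> N" using that assms by (cases "k = N") auto
qed (use assms in auto)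

lemma string_view_columns:
  assumes "0 < m" "0 < n" "2 * (m * n) < 2 ^ w"
  shows "string_view w (m * n) m n"
proof
  have less: "k mod m * n + k div m < m * n" if "k < m * n" for k
  proof -
    have "k div m < n" using that by (metis less_mult_imp_div_less mult.commute)
    hence "k mod m * n + k div m < (k mod m + 1) * n" by simp
    also have "\<dots> \<le> m * n" using assms by (intro mult_le_mono1) (simp add: Suc_leI)
    finally show ?thesis .
  qed
  fix k
  show "k < m * n \<Longrightarrow> k mod m * n + k div m < m * n" by (rule less)
  show "k mod m * n + k div m \<le> m * n" if "k \<le> m * n"
    using that less[of k] assms by (cases "k = m * n") auto
qed (use assms in auto)

text \<open>The two searches cost at most \<open>87 * (m * n)\<close> each, the copy
  \<open>20 * (m * n)\<close> and the glue code 18 steps; the constant 250 leaves slack, using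
  \<open>m * n \<ge> 1\<close>.\<close>

lemma wp_root_program:
  assumes A: "A \<in> carrier_mat m n" and mn: "0 < m" "0 < n" and inj: "inj_on code (elements_mat A)"
    and w: "2 * (m * n) < 2 ^ w" and R: "R 0 = m" "R 1 = n"
    and M: "\<And>a. a < m * n \<Longrightarrow> M a = code (A $$ (a div n, a mod n))"
    and k: "250 * (m * n) \<le> k"
  defines "r \<equiv> least_row_period A" and "c \<equiv> least_row_period (transpose_mat A)"
  shows "wp w root_program (\<lambda>R' M' k'. R' 0 = (if primitive_array A then 1 else 0) \<and>
    R' 1 = r \<and> R' 2 = c \<and> (\<forall>b<r * c. M' b = code (A $$ (b div c, b mod c)))) R M k"
    (is "wp w _ ?U R M k")
proof -
  have ne: "nonempty_array A" using A mn by (auto simp: nonempty_array_def)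
  have r: "0 < r" "r \<le> m" and c: "0 < c" "c \<le> n"
    using least_row_period[OF ne] least_row_period[OF nonempty_array_transpose[OF ne]] A
    by (auto simp: r_def c_def)
  have N: "0 < m * n" and le: "m \<le> m * n" "n \<le> m * n" using mn by simp_all
  interpret rows: string_view w "m * n" "m * n" 1 by (rule string_view_rows[OF N w])
  interpret cols: string_view w "m * n" m n by (rule string_view_columns[OF mn w])

  have inj_T: "inj_on code (elements_mat (transpose_mat A))"
    using inj by (rule inj_on_subset) (auto simp: elements_mat_def)
  have row_least: "r = (LEAST d. 0 < d \<and> d dvd m \<and>
      (\<forall>t. d * n + t < m * n \<longrightarrow> rows.letter M' t = rows.letter M' (d * n + t)))"
    if M': "\<And>a. a < m * n \<Longrightarrow> M' a = M a" for M'
  proof -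
    have "rows.letter M' t = code (A $$ (t div n, t mod n))" if "t < m * n" for t
      unfolding rows.letter_def using that M' M by simp
    from row_period_iff_shift[OF A mn(2) inj this]
    show ?thesis unfolding r_def least_row_period_def by simp
  qed
  \<comment> \<open>Only agreement with \<open>M\<close> on the array is assumed of the memory,
    since the first search has left its table beyond it.\<close>
  have col_least: "c = (LEAST d. 0 < d \<and> d dvd n \<and>
      (\<forall>t. d * m + t < m * n \<longrightarrow> cols.letter M' t = cols.letter M' (d * m + t)))"
    if M': "\<And>a. a < m * n \<Longrightarrow> M' a = M a" for M'
  proof -
    have "cols.letter M' t = code (transpose_mat A $$ (t div m, t mod m))" if "t < n * m" for t
    proof -
      have t: "t < m * n" using that by (simp add: mult.commute)
      have tn: "t div m < n" using that by (metis less_mult_imp_div_less)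
      note lt = cols.addr_less[OF t]
      have "(t mod m * n + t div m) div n = t mod m" "(t mod m * n + t div m) mod n = t div m"
        using tn by simp_all
      thus ?thesis using M'[OF lt] M[OF lt] tn mn A by (simp add: cols.letter_def)
    qed
    from row_period_iff_shift[OF _ mn(1) inj_T this, of n] A
    show ?thesis unfolding c_def least_row_period_def by (simp add: mult.commute[of n m])
  qed

  have finish: "wp w (Basic write_output) ?U R' M' k'"
    if R': "R' 2 = m * n" "R' 3 = 1" "R' 11 = c" "R' 20 = r" "R' 21 = r * c"
      and M': "\<And>b. b < r * c \<Longrightarrow> M' b = M ((b div c) * n + b mod c)" and k': "5 \<le> k'" for R' M' k'
  proof -
    \<comment> \<open>As \<open>r \<le> m\<close> and \<open>c \<le> n\<close>, comparing areas
      compares both dimensions at once, so one truncated difference decides primitivity.\<close>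
    have "m * n - r * c = 0 \<longleftrightarrow> r = m \<and> c = n"
    proof
      assume "m * n - r * c = 0"
      hence rc: "m * n \<le> r * c" by simp
      also have "\<dots> \<le> r * n" using c by simp
      finally have "m = r" using mn r by simp
      moreover have "c = n" using rc c r unfolding \<open>m = r\<close> by simp
      ultimately show "r = m \<and> c = n" by simp
    qed simp
    hence flag: "1 - (m * n - r * c) = (if primitive_array A then 1 else 0)"
      using primitive_array_iff_periods[OF ne] A by (auto simp: r_def c_def)
    have root: "M' b = code (A $$ (b div c, b mod c))" if b: "b < r * c" for b
    proof -
      have "b mod c < n" using c by (meson less_le_trans mod_less_divisor)
      thus ?thesis using M'[OF b] M corner_address_less[OF b r(2) c] by simp
    qed
    have "r < 2 ^ w" "c < 2 ^ w" using r c le w by linarith+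
    thus ?thesis using R' k' root flag by (intro wp_Basic[where n = 5]) auto
  qed

  have second: "wp w ((lce_table ;; period_search) ;; copy_corner ;;
     Basic write_output) ?U R' M' k'"
    if R': "R' 1 = n" "R' 2 = m * n" "R' 3 = 1" "R' 4 = m" "R' 5 = n" "R' 6 = n"
        "R' 7 = m" "R' 20 = r"
      and M': "\<And>a. a < m * n \<Longrightarrow> M' a = M a" and k': "120 * (m * n) \<le> k'" for R' M' k'
  proof (rule wp_Seq, rule cols.wp_least_period[OF _ R'(6,7)], goal_cases)
    case (4 R2 M2 k2)
    have R2: "R2 1 = n" "R2 2 = m * n" "R2 3 = 1" "R2 11 = c" "R2 20 = r"
      using 4(1,3) R' col_least[OF M'] by (simp_all add: same_params_def)
    have M2: "M2 a = M a" if "a < m * n" for a using 4(2) M' that by simp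
    have k2: "20 * (m * n) + 5 \<le> k2" using 4(4) k' N by linarith
    show ?case
    proof (rule wp_Seq, rule wp_copy_corner[OF R2(1,3,4,5) c r(2) N w], goal_cases)
      case (2 R3 M3 k3)
      have "M3 b = M ((b div c) * n + b mod c)" if b: "b < r * c" for b
        using 2(6)[OF b] M2 corner_address_less[OF b r(2) c] by simp
      thus ?case using 2 R2 k2 by (intro finish) auto
    qed (use k2 in simp)
  qed (use R' k' in \<open>simp_all add: cols.params_def mult.commute\<close>)

  have first: "wp w ((lce_table ;; period_search) ;;
     Basic select_columns ;;
     (lce_table ;; period_search) ;; copy_corner ;;
     Basic write_output) ?U R' M k'"
    if R': "R' 0 = m" "R' 1 = n" "R' 2 = m * n" "R' 3 = 1" "R' 4 = m * n" "R' 5 = 1"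
        "R' 6 = m" "R' 7 = n"
      and k': "220 * (m * n) \<le> k'" for R' k'
  proof (rule wp_Seq, rule rows.wp_least_period[OF _ R'(7,8)], goal_cases)
    case 1 show ?case unfolding rows.params_def using R' by blast
  next
    case (4 R2 M2 k2)
    have R2: "R2 0 = m" "R2 1 = n" "R2 2 = m * n" "R2 3 = 1" "R2 11 = r"
      using 4(1,3) R' row_least[of M] by (simp_all add: same_params_def)
    have k2: "120 * (m * n) + 6 \<le> k2" using 4(4) k' N by linarith
    have fit: "r < 2 ^ w" "m < 2 ^ w" "n < 2 ^ w" using r le w by linarith+
    let ?R = "R2(12 := 0, 20 := r, 4 := m, 5 := n, 6 := n, 7 := m)"
    have "wp w ((lce_table ;; period_search) ;; copy_corner ;;
       Basic write_output) ?U ?R M2 (k2 - 6)"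
      by (rule second) (use R2 4(2) k2 in auto)
    thus ?case using R2 k2 fit by (intro wp_Seq[of w "Basic _"] wp_Basic[where n = 6]) auto
  qed (use k' in simp_all)

  have fit: "m < 2 ^ w" "n < 2 ^ w" "m * n < 2 ^ w" "1 < (2 :: nat) ^ w" and k7: "7 \<le> k"
    using le w N k by linarith+
  let ?R = "R(3 := 1, 2 := m * n, 12 := 0, 4 := m * n, 5 := 1, 6 := m, 7 := n)"
  have "wp w ((lce_table ;; period_search) ;;
     Basic select_columns ;;
     (lce_table ;; period_search) ;; copy_corner ;;
     Basic write_output) ?U ?R M (k - 7)"
  proof (rule first)
    show "220 * (m * n) \<le> k - 7" using k N by linarith
  qed (use R in auto)
  thus ?thesis unfolding root_program_def
    using R k7 fit by (intro wp_Seq[of w "Basic _"] wp_Basic[where n = 7]) auto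
qed

section \<open>Word length and the final bound\<close>

lemma power_le_two_power_word:
  assumes "real w \<ge> real k * log 2 (real N + 1)"
  shows "(N + 1) ^ k \<le> 2 ^ w"
proof -
  have "(real N + 1) powr real k = 2 powr (real k * log 2 (real N + 1))"
    by (subst mult.commute) (simp add: powr_powr[symmetric])
  also have "\<dots> \<le> 2 powr real w" using assms by (intro powr_mono) auto
  finally have "real ((N + 1) ^ k) \<le> real (2 ^ w)" by (simp add: powr_realpow add.commute)
  thus ?thesis by (simp only: of_nat_le_iff)
qed

theorem theorem15:
  fixes \<Sigma> :: "'a set" and code :: "'a \<Rightarrow> nat"
  assumes "finite \<Sigma>" and "inj_on code \<Sigma>"
  shows "\<exists>(P :: instr list) (c :: nat) (k :: nat).
           \<forall>(m :: nat) (n :: nat) (A :: 'a mat) (w :: nat).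
             m > 0 \<longrightarrow> n > 0 \<longrightarrow> A \<in> carrier_mat m n \<longrightarrow> elements_mat A \<subseteq> \<Sigma> \<longrightarrow>
             real w \<ge> real k * log 2 (real (m * n) + 1) \<longrightarrow>
             (\<exists>t s. t \<le> c * (m * n) \<and> ram_run P w t (input_config code A) s \<and>
                    output_correct code A s)"
proof -
  define P where "P = compile 0 root_program"
  \<comment> \<open>Finiteness of the alphabet makes this sum an upper bound for every letter
    code.\<close>
  define K where "K = (\<Sum>a\<in>\<Sigma>. code a)"
  have code_less: "code a < 2 ^ K" if "a \<in> \<Sigma>" for a
  proof -
    have "code a \<le> K" unfolding K_def using assms(1) that by (intro member_le_sum) auto
    thus ?thesis using less_exp[of K] by linarith
  qed
  show ?thesis
  \<comment> \<open>Exponent \<open>K\<close> makes letters fit, as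
    \<open>2 ^ K \<le> (m * n + 1) ^ K\<close>; exponent 2 makes table addresses fit, as
    \<open>2 * (m * n) < (m * n + 1) ^ 2\<close>.\<close>
  proof (rule exI[of _ P], rule exI[of _ 250], rule exI[of _ "K + 2"], intro allI impI)
    fix m n :: nat and A :: "'a mat" and w :: nat
    assume mn: "m > 0" "n > 0" and A: "A \<in> carrier_mat m n" and el: "elements_mat A \<subseteq> \<Sigma>"
      and w: "real w \<ge> real (K + 2) * log 2 (real (m * n) + 1)"
    have N: "0 < m * n" and le: "m \<le> m * n" "n \<le> m * n" using mn by simp_all
    have W: "(m * n + 1) ^ (K + 2) \<le> 2 ^ w" by (rule power_le_two_power_word[OF w])
    have "1 * (m * n + 1) ^ 2 \<le> (m * n + 1) ^ K * (m * n + 1) ^ 2" by (intro mult_le_mono1) simp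
    also have "\<dots> \<le> 2 ^ w" using W unfolding power_add .
    finally have "(m * n + 1) ^ 2 \<le> 2 ^ w" by simp
    hence w2: "2 * (m * n) < 2 ^ w" by (simp add: power2_eq_square)
    have "(2 :: nat) ^ K \<le> (m * n + 1) ^ K" using N by (intro power_mono) auto
    also have "\<dots> * 1 \<le> (m * n + 1) ^ K * (m * n + 1) ^ 2" by (intro mult_le_mono2) simp
    also have "\<dots> \<le> 2 ^ w" using W unfolding power_add .
    finally have wK: "(2 :: nat) ^ K \<le> 2 ^ w" by simp
    define s0 where "s0 = input_config code A"
    have s0: "pc s0 = 0" "reg s0 0 = m" "reg s0 1 = n"
      "\<And>a. a < m * n \<Longrightarrow> mem s0 a = code (A $$ (a div n, a mod n))"
      using A by (auto simp: s0_def input_config_def)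
    have "code (A $$ (a div n, a mod n)) < 2 ^ w" if "a < m * n" for a
    proof -
      have "a div n < m" using that by (metis less_mult_imp_div_less)
      hence "A $$ (a div n, a mod n) \<in> \<Sigma>"
        using A mn by (intro subsetD[OF el] elements_matI[of A m n]) auto
      thus ?thesis using code_less wK by (meson less_le_trans)
    qed
    moreover have "m < 2 ^ w" "n < 2 ^ w" using le w2 by linarith+
    ultimately have fits: "fits w s0" using A by (auto simp: fits_def s0_def input_config_def)
    have ne: "nonempty_array A" using A mn by (auto simp: nonempty_array_def)
    let ?r = "least_row_period A" and ?c = "least_row_period (transpose_mat A)"
    have root: "primitive_root A = corner A" by (rule primitive_root_eq_corner[OF ne])
    have inj: "inj_on code (elements_mat A)" using assms(2) el by (rule inj_on_subset)
    have "code_at P (pc s0) (compile (pc s0) root_program)"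
      unfolding code_at_def P_def s0 by (intro exI[of _ "[]"]) simp
    then obtain t s where run: "t \<le> 250 * (m * n)" "(ram_step P w ^^ t) s0 s"
      "pc s = pc s0 + com_length root_program"
      "reg s 0 = (if primitive_array A then 1 else 0)" "reg s 1 = ?r" "reg s 2 = ?c"
      "\<forall>b < ?r * ?c. mem s b = code (A $$ (b div ?c, b mod ?c))"
      using wpD[OF wp_root_program[OF A mn inj w2 s0(2,3,4) order_refl] _ fits] by blast
    have "stores_array code s (corner A)"
      unfolding stores_array_def
    proof (intro allI impI)
      fix i j assume ij: "i < dim_row (corner A)" "j < dim_col (corner A)"
      hence lt: "i < ?r" "j < ?c" by (simp_all add: corner_def)
      have "i * ?c + j < (i + 1) * ?c" using lt by simp
      also have "\<dots> \<le> ?r * ?c" using lt by (intro mult_le_mono1) simp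
      finally have "mem s (i * ?c + j) = code (A $$ (i, j))" using run(7) lt by simp
      thus "mem s (i * dim_col (corner A) + j) = code (corner A $$ (i, j))"
        using lt by (simp add: corner_def)
    qed
    hence "output_correct code A s"
      using run root by (simp add: output_correct_def corner_def)
    moreover have "ram_run P w t (input_config code A) s"
      using run fits s0 by (simp add: ram_run_def halted_def s0_def P_def)
    ultimately show "\<exists>t s. t \<le> 250 * (m * n) \<and> ram_run P w t (input_config code A) s \<and>
      output_correct code A s" using run(1) by blast
  qed
qed

end
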